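(* Suppose $f,g$ satisfy the Basic Assumption (stated in the context). Choose an initial iterate $(y^0,u^0,x^0)$ with $$\|y^0-y^*(x^0)\|\le \min\Big\{\frac{\mu}{2L_{g,2}},\frac{1}{2\sqrt{L_1}}\Big\},\qquad \|u^0-u^*(x^0)\|\le \min\Big\{\frac{5L_1}{2L_{g,2}},\frac{\sqrt{L_1}}{\mu}\Big\}.$$ Then, for any constant inner step size $\gamma_k=\gamma\in(0,1/L_{g,1}]$, there exist a constant outer step size $\alpha_k=\alpha=\Theta(\kappa^{-3})$ and an integer $T\ge\Theta(\kappa)$ such that the algorithm NBO-GD (defined in the context) has the following properties. (a) For all integers $K\ge 1$, $$\min_{0\le k\le K-1}\|\nabla\Phi(x^k)\|^2\le \frac{2\Phi(x^0)-2\Phi^*+4}{\alpha K}=O\Big(\frac{\kappa^3}{K}\Big).$$ That is, NBO-GD finds an $\epsilon$-optimal solution $\bar x$ (i.e. a point with $\|\nabla\Phi(\bar x)\|^2\le\epsilon$) in $K=O(\kappa^3\epsilon^{-1})$ steps. (b) The computational complexity of NBO-GD for finding an $\epsilon$-optimal solution is: $O(\kappa^3/\epsilon)$ gradient computations and Jacobian-vector products, and $O(\kappa^4/\epsilon)$ Hessian-vector products.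
   Context: Setting. $f,g:\mathbb{R}^m\times\mathbb{R}^n\to\mathbb{R}$, $f$ differentiable and $g$ twice differentiable. $\nabla_1,\nabla_2$ denote gradients with respect to the first variable $x\in\mathbb{R}^m$ and second variable $y\in\mathbb{R}^n$; $\nabla^2_{22}g$ is the Hessian of $g$ in $y$ and $\nabla^2_{12}g\in\mathbb{R}^{m\times n}$ is the Jacobian of $\nabla_1 g$ with respect to $y$. $\|\cdot\|$ is the Euclidean norm for vectors and the Frobenius norm for matrices. The bilevel problem is $\min_{x}\Phi(x):=f(x,y^*(x))$ with $y^*(x)=\arg\min_{y}g(x,y)$; $\Phi^*$ is its optimal value. Put $u^*(x):=[\nabla^2_{22}g(x,y^*(x))]^{-1}\nabla_2 f(x,y^*(x))$. Basic Assumption (with positive constants): (a) for every $x$, $g(x,\cdot)$ is strongly convex with parameter $\mu>0$; (b) $\nabla g$ is Lipschitz continuous with constant $L_{g,1}$, and $\nabla^2_{22}g$ and $\nabla^2_{12}g$ are Lipschitz continuous with constant $L_{g,2}$; (c) $\nabla f$ is Lipschitz continuous with constant $L_{f,1}$, and $\|\nabla_2 f(x,y^*(x))\|\le L_{f,0}$ for all $x$; (d) $\|\nabla_1 f(x,y)\|\le C_{f,0}$ for all $x,y$. Constants: $L_1:=L_{f,1}+L_{g,2}L_{f,0}/\mu$, $L:=\max\{L_{g,1},L_{f,1}\}$, $\kappa:=L/\mu$. Algorithm NBO-GD. Input $y^0,u^0,x^0$, iteration numbers $K,T$, step sizes $\alpha_k,\gamma_k$. For $k=0,\dots,K-1$: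 let $d_y^k=\nabla_2 g(x^k,y^k)$ and $d_u^k=\nabla^2_{22}g(x^k,y^k)u^k-\nabla_2 f(x^k,y^k)$; set $v^{-1,k}=w^{-1,k}=0$ and for $t=-1,0,\dots,T-1$ set $$v^{t+1,k}=[I-\gamma_k\nabla^2_{22}g(x^k,y^k)]v^{t,k}+\gamma_k d_y^k,\qquad w^{t+1,k}=[I-\gamma_k\nabla^2_{22}g(x^k,y^k)]w^{t,k}+\gamma_k d_u^k;$$ put $v^k=v^{T,k}$, $w^k=w^{T,k}$, $y^{k+1}=y^k-v^k$, $u^{k+1}=u^k-w^k$, $d_x^k=\nabla_1 f(x^k,y^k)-\nabla^2_{12}g(x^k,y^k)u^k$, $x^{k+1}=x^k-\alpha_k d_x^k$. Complexity conventions. Gradient computations count evaluations of (partial) gradients of $f$ and $g$; Jacobian-vector products count products of $\nabla^2_{12}g$ with a vector; Hessian-vector products count products of $\nabla^2_{22}g$ with a vector. A one-time cost of $O(\kappa\log\kappa)$ gradient computations and Hessian-vector products for obtaining the initial iterate by gradient descent is included in the total. Asymptotic notation is with respect to $\kappa$, $\epsilon^{-1}$, $K$; the constants $L_{f,0},L_{f,1},L_{g,1},L_{g,2},C_{f,0}$, the step size $\gamma$ and $\Phi(x^0)-\Phi^*$ are regarded as fixed. "$T\ge\Theta(\kappa)$" means that $T$ is at least a threshold of order $\kappa$. *)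

theory Defs
  imports "HOL-Analysis.Analysis" "HOL-Library.Monad_Syntax"
begin

text \<open>Points of \<open>\<real>\<^sup>m \<times> \<real>\<^sup>n\<close> are pairs; the library norm of a pair of vectors is the Euclidean norm of
  the concatenated vector, and the library norm of a matrix is the Frobenius norm.\<close>

definition grad :: "('a::real_inner \<Rightarrow> real) \<Rightarrow> 'a \<Rightarrow> 'a" where
  "grad h z = (THE D. GDERIV h z :> D)"

definition grad1 :: "((real^'m) \<times> (real^'n) \<Rightarrow> real) \<Rightarrow> (real^'m) \<times> (real^'n) \<Rightarrow> real^'m" where
  "grad1 h = (\<lambda>(x, y). grad (\<lambda>x'. h (x', y)) x)"

definition grad2 :: "((real^'m) \<times> (real^'n) \<Rightarrow> real) \<Rightarrow> (real^'m) \<times> (real^'n) \<Rightarrow> real^'n" where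
  "grad2 h = (\<lambda>(x, y). grad (\<lambda>y'. h (x, y')) y)"

definition hess22 :: "((real^'m) \<times> (real^'n) \<Rightarrow> real) \<Rightarrow> (real^'m) \<times> (real^'n) \<Rightarrow> real^'n^'n" where
  "hess22 h = (\<lambda>(x, y). jacobian (\<lambda>y'. grad2 h (x, y')) (at y))"

text \<open>\<open>real^'n^'m\<close> is the type of matrices with rows indexed by \<open>'m\<close> and columns by \<open>'n\<close>.\<close>

definition jac12 :: "((real^'m) \<times> (real^'n) \<Rightarrow> real) \<Rightarrow> (real^'m) \<times> (real^'n) \<Rightarrow> real^'n^'m" where
  "jac12 h = (\<lambda>(x, y). jacobian (\<lambda>y'. grad1 h (x, y')) (at y))"

definition strongly_convex :: "real \<Rightarrow> ('a::real_inner \<Rightarrow> real) \<Rightarrow> bool" where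
  "strongly_convex \<mu> h \<longleftrightarrow>
     (\<forall>y z. \<forall>t\<in>{0..1}. h ((1 - t) *\<^sub>R y + t *\<^sub>R z)
        \<le> (1 - t) * h y + t * h z - \<mu> / 2 * t * (1 - t) * (norm (y - z))\<^sup>2)"

definition y_star :: "((real^'m) \<times> (real^'n) \<Rightarrow> real) \<Rightarrow> real^'m \<Rightarrow> real^'n" where
  "y_star g x = (ARG_MIN (\<lambda>y. g (x, y)) y. True)"

definition Phi :: "((real^'m) \<times> (real^'n) \<Rightarrow> real) \<Rightarrow> ((real^'m) \<times> (real^'n) \<Rightarrow> real)
    \<Rightarrow> real^'m \<Rightarrow> real" where
  "Phi f g x = f (x, y_star g x)"

text \<open>Only meaningful if \<open>Phi f g\<close> is bounded below.\<close>

definition Phi_opt :: "((real^'m) \<times> (real^'n) \<Rightarrow> real) \<Rightarrow> ((real^'m) \<times> (real^'n) \<Rightarrow> real)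
    \<Rightarrow> real" where
  "Phi_opt f g = (INF x. Phi f g x)"

definition u_star :: "((real^'m) \<times> (real^'n) \<Rightarrow> real) \<Rightarrow> ((real^'m) \<times> (real^'n) \<Rightarrow> real)
    \<Rightarrow> real^'m \<Rightarrow> real^'n" where
  "u_star f g x = matrix_inv (hess22 g (x, y_star g x)) *v grad2 f (x, y_star g x)"

definition basic_assumption ::
  "((real^'m) \<times> (real^'n) \<Rightarrow> real) \<Rightarrow> ((real^'m) \<times> (real^'n) \<Rightarrow> real)
    \<Rightarrow> real \<Rightarrow> real \<Rightarrow> real \<Rightarrow> real \<Rightarrow> real \<Rightarrow> real \<Rightarrow> bool" where
  "basic_assumption f g \<mu> Lf0 Lf1 Lg1 Lg2 Cf0 \<longleftrightarrow>
     \<mu> > 0 \<and> Lf0 > 0 \<and> Lf1 > 0 \<and> Lg1 > 0 \<and> Lg2 > 0 \<and> Cf0 > 0 \<and>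
     (\<forall>z. f differentiable (at z)) \<and>
     (\<forall>z. g differentiable (at z)) \<and> (\<forall>z. grad g differentiable (at z)) \<and>
     (\<forall>x. strongly_convex \<mu> (\<lambda>y. g (x, y))) \<and>
     Lg1-lipschitz_on UNIV (grad g) \<and>
     Lg2-lipschitz_on UNIV (hess22 g) \<and>
     Lg2-lipschitz_on UNIV (jac12 g) \<and>
     Lf1-lipschitz_on UNIV (grad f) \<and>
     (\<forall>x. norm (grad2 f (x, y_star g x)) \<le> Lf0) \<and>
     (\<forall>z. norm (grad1 f z) \<le> Cf0)"

definition L1_const :: "real \<Rightarrow> real \<Rightarrow> real \<Rightarrow> real \<Rightarrow> real" where
  "L1_const \<mu> Lf0 Lf1 Lg2 = Lf1 + Lg2 * Lf0 / \<mu>"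

definition cond_number :: "real \<Rightarrow> real \<Rightarrow> real \<Rightarrow> real" where
  "cond_number \<mu> Lf1 Lg1 = max Lg1 Lf1 / \<mu>"

definition good_init ::
  "((real^'m) \<times> (real^'n) \<Rightarrow> real) \<Rightarrow> ((real^'m) \<times> (real^'n) \<Rightarrow> real) \<Rightarrow> real \<Rightarrow> real \<Rightarrow> real
    \<Rightarrow> real \<Rightarrow> real^'n \<Rightarrow> real^'n \<Rightarrow> real^'m \<Rightarrow> bool" where
  "good_init f g \<mu> Lf0 Lf1 Lg2 y0 u0 x0 \<longleftrightarrow>
     (let L1 = L1_const \<mu> Lf0 Lf1 Lg2 in
        norm (y0 - y_star g x0) \<le> min (\<mu> / (2 * Lg2)) (1 / (2 * sqrt L1)) \<and>
        norm (u0 - u_star f g x0) \<le> min (5 * L1 / (2 * Lg2)) (sqrt L1 / \<mu>))"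

text \<open>Computations instrumented with the number of (partial) gradient evaluations, of products of
  \<open>jac12 g\<close> with a vector, and of products of \<open>hess22 g\<close> with a vector.\<close>

datatype 'a counted = Counted (result: 'a) (grads: nat) (jvps: nat) (hvps: nat)

definition pure :: "'a \<Rightarrow> 'a counted" where
  "pure a = Counted a 0 0 0"

definition bind_counted :: "'a counted \<Rightarrow> ('a \<Rightarrow> 'b counted) \<Rightarrow> 'b counted" where
  "bind_counted c k =
     (let r = k (result c) in
        Counted (result r) (grads c + grads r) (jvps c + jvps r) (hvps c + hvps r))"

adhoc_overloading Monad_Syntax.bind \<rightleftharpoons> bind_counted

definition eval_grad1 ::
  "((real^'m) \<times> (real^'n) \<Rightarrow> real) \<Rightarrow> (real^'m) \<times> (real^'n) \<Rightarrow> (real^'m) counted" where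
  "eval_grad1 h z = Counted (grad1 h z) 1 0 0"

definition eval_grad2 ::
  "((real^'m) \<times> (real^'n) \<Rightarrow> real) \<Rightarrow> (real^'m) \<times> (real^'n) \<Rightarrow> (real^'n) counted" where
  "eval_grad2 h z = Counted (grad2 h z) 1 0 0"

definition jvp ::
  "((real^'m) \<times> (real^'n) \<Rightarrow> real) \<Rightarrow> (real^'m) \<times> (real^'n) \<Rightarrow> real^'n \<Rightarrow> (real^'m) counted" where
  "jvp h z v = Counted (jac12 h z *v v) 0 1 0"

definition hvp ::
  "((real^'m) \<times> (real^'n) \<Rightarrow> real) \<Rightarrow> (real^'m) \<times> (real^'n) \<Rightarrow> real^'n \<Rightarrow> (real^'n) counted" where
  "hvp h z v = Counted (hess22 h z *v v) 0 0 1"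

text \<open>\<open>inner_loop g \<gamma> z d N\<close> is the inner iterate with index \<open>N - 1\<close>: the inner index of the algorithm
  starts at \<open>-1\<close>, so the iterate with index \<open>T\<close> is reached after \<open>Suc T\<close> updates.\<close>

primrec inner_loop ::
  "((real^'m) \<times> (real^'n) \<Rightarrow> real) \<Rightarrow> real \<Rightarrow> (real^'m) \<times> (real^'n) \<Rightarrow> real^'n \<Rightarrow> nat
    \<Rightarrow> (real^'n) counted" where
  "inner_loop g \<gamma> z d 0 = pure 0"
| "inner_loop g \<gamma> z d (Suc N) =
     do { v \<leftarrow> inner_loop g \<gamma> z d N;
          hv \<leftarrow> hvp g z v;
          pure (v - \<gamma> *\<^sub>R hv + \<gamma> *\<^sub>R d) }"

text \<open>The state of the algorithm is the triple \<open>(y, u, x)\<close>.\<close>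

type_synonym ('m, 'n) nbo_state = "(real^'n) \<times> (real^'n) \<times> (real^'m)"

definition nbo_step ::
  "((real^'m) \<times> (real^'n) \<Rightarrow> real) \<Rightarrow> ((real^'m) \<times> (real^'n) \<Rightarrow> real) \<Rightarrow> nat \<Rightarrow> real \<Rightarrow> real
    \<Rightarrow> ('m, 'n) nbo_state \<Rightarrow> ('m, 'n) nbo_state counted" where
  "nbo_step f g T \<alpha> \<gamma> = (\<lambda>(y, u, x).
     do { dy \<leftarrow> eval_grad2 g (x, y);
          hu \<leftarrow> hvp g (x, y) u;
          f2 \<leftarrow> eval_grad2 f (x, y);
          v \<leftarrow> inner_loop g \<gamma> (x, y) dy (Suc T);
          w \<leftarrow> inner_loop g \<gamma> (x, y) (hu - f2) (Suc T);
          f1 \<leftarrow> eval_grad1 f (x, y);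
          ju \<leftarrow> jvp g (x, y) u;
          pure (y - v, u - w, x - \<alpha> *\<^sub>R (f1 - ju)) })"

text \<open>NBO-GD after \<open>k\<close> outer iterations.\<close>

primrec nbo_gd ::
  "((real^'m) \<times> (real^'n) \<Rightarrow> real) \<Rightarrow> ((real^'m) \<times> (real^'n) \<Rightarrow> real) \<Rightarrow> nat
    \<Rightarrow> (nat \<Rightarrow> real) \<Rightarrow> (nat \<Rightarrow> real) \<Rightarrow> ('m, 'n) nbo_state \<Rightarrow> nat
    \<Rightarrow> ('m, 'n) nbo_state counted" where
  "nbo_gd f g T \<alpha>s \<gamma>s s0 0 = pure s0"
| "nbo_gd f g T \<alpha>s \<gamma>s s0 (Suc k) =
     do { s \<leftarrow> nbo_gd f g T \<alpha>s \<gamma>s s0 k;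
          nbo_step f g T (\<alpha>s k) (\<gamma>s k) s }"

definition x_iter ::
  "((real^'m) \<times> (real^'n) \<Rightarrow> real) \<Rightarrow> ((real^'m) \<times> (real^'n) \<Rightarrow> real) \<Rightarrow> nat
    \<Rightarrow> (nat \<Rightarrow> real) \<Rightarrow> (nat \<Rightarrow> real) \<Rightarrow> ('m, 'n) nbo_state \<Rightarrow> nat \<Rightarrow> real^'m" where
  "x_iter f g T \<alpha>s \<gamma>s s0 k = snd (snd (result (nbo_gd f g T \<alpha>s \<gamma>s s0 k)))"

definition eps_optimal :: "((real^'m) \<times> (real^'n) \<Rightarrow> real) \<Rightarrow> ((real^'m) \<times> (real^'n) \<Rightarrow> real)
    \<Rightarrow> real \<Rightarrow> real^'m \<Rightarrow> bool" where
  "eps_optimal f g \<epsilon> x \<longleftrightarrow> (norm (grad (Phi f g) x))\<^sup>2 \<le> \<epsilon>"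

text \<open>A one-time initialisation cost of order \<open>\<kappa> log \<kappa>\<close>. The summand \<open>1\<close> only matters for \<open>\<kappa>\<close> near \<open>1\<close>,
  where \<open>\<kappa> ln \<kappa>\<close> vanishes.\<close>

definition init_cost_bound :: "real \<Rightarrow> real \<Rightarrow> nat \<Rightarrow> bool" where
  "init_cost_bound C \<kappa> N \<longleftrightarrow> real N \<le> C * (\<kappa> * (1 + ln \<kappa>))"

end

theory Submission
  imports Defs
begin

text \<open>
  The method runs, along a slowly moving point \<open>x\<close>, an inexact Newton method for the lower-level minimiser
  \<open>y_star g x\<close> and for the solution \<open>u_star f g x\<close> of a linear system with the lower-level Hessian. Three
  facts make it converge.

  First, the Newton errors contract by a fixed factor. The inner loop solves the Newton system up to the
  relative error \<open>(1 - \<gamma> \<mu>)\<^sup>T\<^sup>+\<^sup>1\<close>, because \<open>I - \<gamma> H\<close> is symmetric and positive semidefinite with largest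
  eigenvalue at most \<open>1 - \<gamma> \<mu>\<close>. Inside the ball of radius \<open>\<mu> / (2 Lg2)\<close> an exact Newton step halves the
  error of \<open>y\<close>, so the fixed relative error \<open>1 / 6\<close> is good enough, and a number \<open>T\<close> of inner iterations
  proportional to \<open>\<kappa>\<close> achieves it (\<open>inexact_newton_y\<close>, \<open>inexact_newton_u\<close>).

  Second, the targets move slowly. \<open>y_star\<close> is Lipschitz with constant \<open>Lg1 / \<mu>\<close>, which is \<open>O(\<kappa>)\<close>, and
  \<open>u_star\<close> with a constant of order \<open>\<kappa>\<^sup>3\<close>, while the search direction has size \<open>O(\<kappa>)\<close>. With a step size of
  order \<open>\<kappa>\<^sup>-\<^sup>3\<close> the displacement never leads out of the region of fast convergence
  (\<open>errors_stay_small\<close>).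

  Third, \<open>Phi\<close> is differentiable, its gradient is the hypergradient \<open>grad1 f - J u\<close> at \<open>y = y_star\<close>,
  \<open>u = u_star\<close>, and this gradient is Lipschitz with constant \<open>L1 (1 + Lg1 / \<mu>)\<^sup>2\<close>, of order \<open>\<kappa>\<^sup>3\<close>
  (\<open>gderiv_Phi\<close>, \<open>lip_dPhi\<close>). Hence a step along the approximate hypergradient decreases \<open>Phi\<close> up to the
  squares of the two errors. Adding suitable multiples of these squares to \<open>Phi\<close> gives a potential that
  drops by at least \<open>\<alpha> / 2 |\<nabla>Phi|\<^sup>2\<close> in every step (\<open>potential_decrease\<close>); initially it exceeds \<open>Phi\<close> by at
  most \<open>2\<close>. Summing over the steps bounds the average, and so the minimum, of \<open>|\<nabla>Phi|\<^sup>2\<close>. The operation counts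
  follow, since one step costs three gradients, one Jacobian-vector product and \<open>2 T + 3\<close> Hessian-vector
  products.
\<close>

section \<open>Gradients and second derivatives\<close>

lemma has_gradient_grad:
  fixes h :: "'a::euclidean_space \<Rightarrow> real"
  assumes "h differentiable at z"
  shows "GDERIV h z :> grad h z"
proof -
  obtain F where F: "(h has_derivative F) (at z)"
    using assms by (auto simp: differentiable_def)
  then interpret bounded_linear F by (rule has_derivative_bounded_linear)
  define D where "D = (\<Sum>b\<in>Basis. F b *\<^sub>R b)"
  have "F v = v \<bullet> D" for v
  proof -
    have "F v = F (\<Sum>b\<in>Basis. (v \<bullet> b) *\<^sub>R b)" by (simp add: euclidean_representation)
    also have "\<dots> = v \<bullet> D" by (simp add: sum scale D_def inner_sum_right mult.commute)
    finally show ?thesis .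
  qed
  then have D: "GDERIV h z :> D"
    using F by (simp add: gderiv_def) (metis (no_types, lifting) ext)
  moreover have "D' = D" if "GDERIV h z :> D'" for D'
  proof -
    have "(\<lambda>v. v \<bullet> D') = (\<lambda>v. v \<bullet> D)"
      using that D unfolding gderiv_def by (rule has_derivative_unique)
    then have "(D' - D) \<bullet> (D' - D) = 0"
      by (metis inner_diff_right right_minus_eq)
    then show ?thesis by simp
  qed
  ultimately show ?thesis unfolding grad_def by (rule theI)
qed

lemma grad_eqI:
  fixes h :: "'a::euclidean_space \<Rightarrow> real"
  assumes "GDERIV h z :> D"
  shows "grad h z = D"
proof -
  have "GDERIV h z :> grad h z"
    using assms by (intro has_gradient_grad) (auto simp: gderiv_def differentiable_def)
  then have "(\<lambda>v. v \<bullet> grad h z) = (\<lambda>v. v \<bullet> D)"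
    using assms unfolding gderiv_def by (rule has_derivative_unique)
  then have "(grad h z - D) \<bullet> (grad h z - D) = 0"
    by (metis inner_diff_right right_minus_eq)
  then show ?thesis by simp
qed

text \<open>The second difference of \<open>g\<close> is the increment over \<open>[0, 1]\<close> of
  \<open>s \<mapsto> g (z + s h + k) - g (z + s h)\<close>. By the mean value theorem it equals the inner product of \<open>h\<close>
  with a difference of two gradients; linearising both at \<open>z\<close>, the contributions of \<open>s h\<close> cancel and
  \<open>D k\<close> remains.\<close>

lemma second_difference_approx:
  fixes g :: "'a::real_inner \<Rightarrow> real"
  assumes grad: "\<And>z. GDERIV g z :> G z"
    and lin: "linear D"
    and approx: "\<And>v. norm v < d \<Longrightarrow> norm (G (z + v) - G z - D v) \<le> e * norm v"
    and small: "norm h + norm k < d" and e: "e \<ge> 0"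
  shows "\<bar>g (z + h + k) - g (z + h) - g (z + k) + g z - h \<bullet> D k\<bar> \<le> 2 * e * (norm h + norm k)\<^sup>2"
proof -
  interpret linear D by fact
  define \<phi> where "\<phi> s = g (z + s *\<^sub>R h + k) - g (z + s *\<^sub>R h)" for s :: real
  have d\<phi>: "(\<phi> has_derivative (\<lambda>r. (r *\<^sub>R h) \<bullet> G (z + s *\<^sub>R h + k) - (r *\<^sub>R h) \<bullet> G (z + s *\<^sub>R h))) (at s)" for s
  proof -
    have 1: "((\<lambda>s. g (z + s *\<^sub>R h + k)) has_derivative (\<lambda>r. (r *\<^sub>R h) \<bullet> G (z + s *\<^sub>R h + k))) (at s)"
      by (rule has_derivative_compose[where f = "\<lambda>s. z + s *\<^sub>R h + k", OF _ grad[unfolded gderiv_def]])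
         (auto intro!: derivative_eq_intros)
    have 2: "((\<lambda>s. g (z + s *\<^sub>R h)) has_derivative (\<lambda>r. (r *\<^sub>R h) \<bullet> G (z + s *\<^sub>R h))) (at s)"
      by (rule has_derivative_compose[where f = "\<lambda>s. z + s *\<^sub>R h", OF _ grad[unfolded gderiv_def]])
         (auto intro!: derivative_eq_intros)
    show ?thesis unfolding \<phi>_def by (rule has_derivative_diff[OF 1 2])
  qed
  have "\<exists>s\<in>{0<..<1}. \<phi> 1 - \<phi> 0 = (\<lambda>r. (r *\<^sub>R h) \<bullet> G (z + s *\<^sub>R h + k) - (r *\<^sub>R h) \<bullet> G (z + s *\<^sub>R h)) (1 - 0)"
    by (rule mvt_simple) (rule zero_less_one, rule has_derivative_at_withinI[OF d\<phi>])
  then obtain s where s: "0 < s" "s < 1"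
    and eq: "\<phi> 1 - \<phi> 0 = h \<bullet> (G (z + s *\<^sub>R h + k) - G (z + s *\<^sub>R h))"
    by (auto simp: inner_diff_right)
  let ?N = "norm h + norm k"
  have sh: "norm (s *\<^sub>R h) \<le> norm h" using s by (simp add: mult_left_le_one_le)
  have shk: "norm (s *\<^sub>R h + k) \<le> ?N"
    using norm_triangle_ineq[of "s *\<^sub>R h" k] sh by linarith
  have A: "norm (G (z + (s *\<^sub>R h + k)) - G z - D (s *\<^sub>R h + k)) \<le> e * ?N"
    using approx[of "s *\<^sub>R h + k"] shk small mult_left_mono[OF shk e] by linarith
  have sh': "norm (s *\<^sub>R h) \<le> ?N" using sh norm_ge_zero[of k] by linarith
  have B: "norm (G (z + s *\<^sub>R h) - G z - D (s *\<^sub>R h)) \<le> e * ?N"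
    using approx[of "s *\<^sub>R h"] sh' small mult_left_mono[OF sh' e] by linarith
  have "g (z + h + k) - g (z + h) - g (z + k) + g z - h \<bullet> D k
      = h \<bullet> ((G (z + (s *\<^sub>R h + k)) - G z - D (s *\<^sub>R h + k)) - (G (z + s *\<^sub>R h) - G z - D (s *\<^sub>R h)))"
    using eq by (simp add: \<phi>_def inner_diff_right inner_add_right add add.assoc)
  also have "\<bar>\<dots>\<bar> \<le> norm h * norm ((G (z + (s *\<^sub>R h + k)) - G z - D (s *\<^sub>R h + k)) - (G (z + s *\<^sub>R h) - G z - D (s *\<^sub>R h)))"
    by (rule Cauchy_Schwarz_ineq2)
  also have "\<dots> \<le> norm h * (2 * e * ?N)"
    using norm_triangle_ineq4[of "G (z + (s *\<^sub>R h + k)) - G z - D (s *\<^sub>R h + k)" "G (z + s *\<^sub>R h) - G z - D (s *\<^sub>R h)"] A B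
    by (intro mult_left_mono) auto
  also have "\<dots> \<le> ?N * (2 * e * ?N)"
    using e by (intro mult_right_mono) auto
  finally show ?thesis by (simp add: power2_eq_square algebra_simps)
qed

text \<open>The second difference in the directions \<open>t h\<close> and \<open>t k\<close> does not depend on their order, and by
  differentiability of the gradient at \<open>z\<close> it approximates both bilinear expressions up to \<open>o(t\<^sup>2)\<close>.\<close>

lemma second_derivative_symmetric:
  fixes g :: "'a::real_inner \<Rightarrow> real"
  assumes grad: "\<And>z. GDERIV g z :> G z"
    and D: "(G has_derivative D) (at z)"
  shows "h \<bullet> D k = k \<bullet> D h"
proof -
  have lin: "linear D" using D by (rule has_derivative_linear)
  interpret linear D by fact
  let ?N = "norm h + norm k"
  have "\<bar>h \<bullet> D k - k \<bullet> D h\<bar> \<le> e" if e: "e > 0" for e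
  proof -
    define e' where "e' = e / (4 * (?N\<^sup>2 + 1))"
    have "?N\<^sup>2 + 1 > 0" by (simp add: add_nonneg_pos)
    then have e': "e' > 0" "4 * e' * ?N\<^sup>2 \<le> e"
      using e by (auto simp: e'_def field_simps)
    from D e'(1) obtain d where d: "d > 0"
      "\<And>y. norm (y - z) < d \<Longrightarrow> norm (G y - G z - D (y - z)) \<le> e' * norm (y - z)"
      unfolding has_derivative_at_alt by meson
    have approx: "norm (G (z + v) - G z - D v) \<le> e' * norm v" if "norm v < d" for v
      using d(2)[of "z + v"] that by simp
    define t where "t = d / (2 * (?N + 1))"
    have N1: "?N + 1 > 0" by (simp add: add_nonneg_pos)
    have t: "t > 0" using d(1) N1 by (simp add: t_def)
    have tN: "norm (t *\<^sub>R h) + norm (t *\<^sub>R k) = t * ?N" using t by (simp add: algebra_simps)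
    have "t * ?N < d"
    proof -
      have "?N < 2 * (?N + 1)" by (smt (verit) norm_ge_zero)
      then have "d * ?N < d * (2 * (?N + 1))" using d(1) by (rule mult_strict_left_mono)
      then show ?thesis using N1 unfolding t_def by (simp add: pos_divide_less_eq)
    qed
    then have small: "norm (t *\<^sub>R h) + norm (t *\<^sub>R k) < d" "norm (t *\<^sub>R k) + norm (t *\<^sub>R h) < d"
      using tN by linarith+
    note 1 = second_difference_approx[OF grad lin approx small(1) less_imp_le[OF e'(1)]]
    note 2 = second_difference_approx[OF grad lin approx small(2) less_imp_le[OF e'(1)]]
    have eq: "g (z + t *\<^sub>R k + t *\<^sub>R h) = g (z + t *\<^sub>R h + t *\<^sub>R k)"
      by (simp add: add.commute add.left_commute)
    have "\<bar>(t *\<^sub>R h) \<bullet> D (t *\<^sub>R k) - (t *\<^sub>R k) \<bullet> D (t *\<^sub>R h)\<bar> \<le> 4 * e' * (t * ?N)\<^sup>2"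
      using 1 2 unfolding eq tN add.commute[of "norm (t *\<^sub>R k)"] by linarith
    then have "t\<^sup>2 * \<bar>h \<bullet> D k - k \<bullet> D h\<bar> \<le> t\<^sup>2 * (4 * e' * ?N\<^sup>2)"
      by (simp add: scale power2_eq_square abs_mult right_diff_distrib[symmetric] mult_ac)
    then have "\<bar>h \<bullet> D k - k \<bullet> D h\<bar> \<le> 4 * e' * ?N\<^sup>2"
      using t by (simp add: mult_le_cancel_left_pos)
    then show ?thesis using e'(2) by linarith
  qed
  then show ?thesis by (metis abs_le_zero_iff eq_iff_diff_eq_0 field_le_epsilon add_0)
qed

lemma derivative_norm_le_lipschitz:
  fixes F :: "'a::real_normed_vector \<Rightarrow> 'b::real_normed_vector"
  assumes D: "(F has_derivative D) (at z)" and lip: "C-lipschitz_on UNIV F"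
  shows "norm (D w) \<le> C * norm w"
proof (cases "w = 0")
  case True
  then show ?thesis using linear_0[OF has_derivative_linear[OF D]] by simp
next
  case False
  interpret linear D using D by (rule has_derivative_linear)
  have "norm (D w) \<le> C * norm w + e" if e: "e > 0" for e
  proof -
    have "e / norm w > 0" using e False by simp
    with D obtain d where d: "d > 0"
      "\<And>y. norm (y - z) < d \<Longrightarrow> norm (F y - F z - D (y - z)) \<le> e / norm w * norm (y - z)"
      unfolding has_derivative_at_alt by meson
    define t where "t = d / (2 * norm w)"
    have t: "t > 0" "norm (t *\<^sub>R w) < d" using d(1) False by (auto simp: t_def)
    have 1: "norm (F (z + t *\<^sub>R w) - F z - t *\<^sub>R D w) \<le> e / norm w * norm (t *\<^sub>R w)"
      using d(2)[of "z + t *\<^sub>R w"] t(2) by (simp add: scale)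
    have 2: "norm (F (z + t *\<^sub>R w) - F z) \<le> C * norm (t *\<^sub>R w)"
      using lipschitz_onD[OF lip, of "z + t *\<^sub>R w" z] by (simp add: dist_norm)
    have "norm (t *\<^sub>R D w) \<le> C * norm (t *\<^sub>R w) + e / norm w * norm (t *\<^sub>R w)"
      using norm_triangle_ineq4[of "F (z + t *\<^sub>R w) - F z" "F (z + t *\<^sub>R w) - F z - t *\<^sub>R D w"] 1 2 by simp
    then have "t * norm (D w) \<le> t * (C * norm w + e)"
      using t False by (simp add: algebra_simps)
    then show ?thesis using t by simp
  qed
  then show ?thesis by (rule field_le_epsilon)
qed

text \<open>A single application of the mean value theorem gives the constant \<open>C\<close> instead of the sharp
  \<open>C / 2\<close>; the difference is absorbed by the constant in the step size.\<close>

lemma lipschitz_gradient_descent: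
  fixes h :: "'a::real_inner \<Rightarrow> real"
  assumes grad: "\<And>z. GDERIV h z :> G z"
    and lip: "\<And>z z'. norm (G z - G z') \<le> C * norm (z - z')" and C: "C \<ge> 0"
  shows "h (z + v) \<le> h z + v \<bullet> G z + C * (norm v)\<^sup>2"
proof -
  define \<phi> where "\<phi> s = h (z + s *\<^sub>R v)" for s :: real
  have d\<phi>: "(\<phi> has_derivative (\<lambda>r. (r *\<^sub>R v) \<bullet> G (z + s *\<^sub>R v))) (at s)" for s
    unfolding \<phi>_def
    by (rule has_derivative_compose[where f = "\<lambda>s. z + s *\<^sub>R v", OF _ grad[unfolded gderiv_def]])
       (auto intro!: derivative_eq_intros)
  have "\<exists>s\<in>{0<..<1}. \<phi> 1 - \<phi> 0 = (\<lambda>r. (r *\<^sub>R v) \<bullet> G (z + s *\<^sub>R v)) (1 - 0)"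
    by (rule mvt_simple) (rule zero_less_one, rule has_derivative_at_withinI[OF d\<phi>])
  then obtain s where s: "0 < s" "s < 1" and eq: "\<phi> 1 - \<phi> 0 = v \<bullet> G (z + s *\<^sub>R v)"
    by auto
  have "v \<bullet> (G (z + s *\<^sub>R v) - G z) \<le> norm v * norm (G (z + s *\<^sub>R v) - G z)"
    by (rule norm_cauchy_schwarz)
  also have "\<dots> \<le> norm v * (C * (s * norm v))"
    using lip[of "z + s *\<^sub>R v" z] s by (intro mult_left_mono) auto
  also have "\<dots> \<le> norm v * (C * norm v)"
    using s C by (intro mult_left_mono) (auto simp: mult_left_le_one_le)
  finally show ?thesis
    using eq by (simp add: \<phi>_def inner_diff_right power2_eq_square mult_ac)
qed

section \<open>Strong convexity\<close>

text \<open>Strong convexity bounds the difference quotients of \<open>h\<close> at \<open>y\<close> in the direction \<open>z - y\<close>; the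
  claim is the limit of that bound as the quotient tends to the directional derivative.\<close>

lemma strongly_convex_lower_bound:
  fixes h :: "'a::real_inner \<Rightarrow> real"
  assumes sc: "strongly_convex \<mu> h" and D: "GDERIV h y :> D"
  shows "h z \<ge> h y + (z - y) \<bullet> D + \<mu> / 2 * (norm (z - y))\<^sup>2"
proof -
  define \<phi> where "\<phi> t = h (y + t *\<^sub>R (z - y))" for t :: real
  have "(\<phi> has_derivative (\<lambda>r. (r *\<^sub>R (z - y)) \<bullet> D)) (at 0)"
    unfolding \<phi>_def
    by (rule has_derivative_compose[where f = "\<lambda>s. y + s *\<^sub>R (z - y)"])
       (use D in \<open>auto intro!: derivative_eq_intros simp: gderiv_def\<close>)
  then have "DERIV \<phi> 0 :> (z - y) \<bullet> D"
    by (simp add: has_field_derivative_def mult_commute_abs)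
  then have "((\<lambda>t. (\<phi> t - \<phi> 0) / t) \<longlongrightarrow> (z - y) \<bullet> D) (at 0)"
    by (simp add: DERIV_def)
  then have lim: "((\<lambda>t. (\<phi> t - \<phi> 0) / t) \<longlongrightarrow> (z - y) \<bullet> D) (at_right 0)"
    by (rule filterlim_mono) (auto simp: at_le)
  have lim2: "((\<lambda>t. h z - h y - \<mu> / 2 * (1 - t) * (norm (z - y))\<^sup>2)
      \<longlongrightarrow> h z - h y - \<mu> / 2 * (1 - 0) * (norm (z - y))\<^sup>2) (at_right 0)"
    by (intro tendsto_intros)
  have "eventually (\<lambda>t. (\<phi> t - \<phi> 0) / t \<le> h z - h y - \<mu> / 2 * (1 - t) * (norm (z - y))\<^sup>2) (at_right 0)"
  proof -
    have "(\<phi> t - \<phi> 0) / t \<le> h z - h y - \<mu> / 2 * (1 - t) * (norm (z - y))\<^sup>2" if t: "0 < t" "t < 1" for t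
    proof -
      have eq: "y + t *\<^sub>R (z - y) = (1 - t) *\<^sub>R y + t *\<^sub>R z" by (simp add: algebra_simps)
      have "\<phi> t \<le> (1 - t) * h y + t * h z - \<mu> / 2 * t * (1 - t) * (norm (y - z))\<^sup>2"
        using sc t unfolding strongly_convex_def \<phi>_def eq by auto
      then have "\<phi> t - \<phi> 0 \<le> t * (h z - h y - \<mu> / 2 * (1 - t) * (norm (z - y))\<^sup>2)"
        by (simp add: \<phi>_def algebra_simps norm_minus_commute)
      then show ?thesis using t by (simp add: field_simps)
    qed
    then show ?thesis
      unfolding eventually_at_right_field by (intro exI[of _ 1]) auto
  qed
  then have "(z - y) \<bullet> D \<le> h z - h y - \<mu> / 2 * (1 - 0) * (norm (z - y))\<^sup>2"
    using lim lim2 by (intro tendsto_le[OF _ lim2 lim]) auto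
  then show ?thesis by simp
qed

lemma strongly_convex_strongly_monotone:
  fixes h :: "'a::real_inner \<Rightarrow> real"
  assumes sc: "strongly_convex \<mu> h" and "GDERIV h y :> D" "GDERIV h z :> E"
  shows "(z - y) \<bullet> (E - D) \<ge> \<mu> * (norm (z - y))\<^sup>2"
  using strongly_convex_lower_bound[OF sc assms(2), of z]
    strongly_convex_lower_bound[OF sc assms(3), of y]
  by (simp add: norm_minus_commute inner_diff_left inner_diff_right algebra_simps)

text \<open>The quadratic minorant at the origin exceeds \<open>h 0\<close> outside the ball of radius
  \<open>2 |\<nabla>h(0)| / \<mu>\<close>, so a minimiser over this compact ball is a global one.\<close>

lemma strongly_convex_attains_min:
  fixes h :: "'a::euclidean_space \<Rightarrow> real"
  assumes sc: "strongly_convex \<mu> h" and \<mu>: "\<mu> > 0" and diff: "\<And>y. h differentiable at y"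
  shows "\<exists>y. \<forall>z. h y \<le> h z"
proof -
  define D where "D = grad h 0"
  have lower: "h z \<ge> h 0 + z \<bullet> D + \<mu> / 2 * (norm z)\<^sup>2" for z
    using strongly_convex_lower_bound[OF sc has_gradient_grad[OF diff], of 0 z] by (simp add: D_def)
  define R where "R = 2 * norm D / \<mu>"
  have R: "R \<ge> 0" using \<mu> by (simp add: R_def)
  have "continuous_on (cball 0 R) h"
    using diff by (auto intro!: continuous_at_imp_continuous_on differentiable_imp_continuous_within)
  then obtain y where y: "\<forall>z\<in>cball 0 R. h y \<le> h z"
    using continuous_attains_inf[OF compact_cball, of 0 R h] R by (auto simp: cball_eq_empty)
  have "h y \<le> h z" for z
  proof (cases "norm z \<le> R")
    case True
    then show ?thesis using y by simp
  next
    case False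
    then have "2 * norm D \<le> \<mu> * norm z" using \<mu> by (simp add: R_def field_simps)
    then have "norm z * norm D \<le> norm z * (\<mu> / 2 * norm z)" by (intro mult_left_mono) auto
    moreover have "- (z \<bullet> D) \<le> norm z * norm D" using Cauchy_Schwarz_ineq2[of z D] by linarith
    ultimately have "h z \<ge> h 0" using lower[of z] by (simp add: power2_eq_square mult_ac)
    moreover have "h y \<le> h 0" using y R by simp
    ultimately show ?thesis by simp
  qed
  then show ?thesis by blast
qed

lemma derivative_strongly_monotone:
  fixes F :: "'a::real_inner \<Rightarrow> 'a"
  assumes D: "(F has_derivative D) (at y)"
    and mono: "\<And>z. (z - y) \<bullet> (F z - F y) \<ge> \<mu> * (norm (z - y))\<^sup>2"
  shows "v \<bullet> D v \<ge> \<mu> * (norm v)\<^sup>2"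
proof (cases "v = 0")
  case True then show ?thesis by simp
next
  case False
  interpret linear D using D by (rule has_derivative_linear)
  have "\<mu> * (norm v)\<^sup>2 \<le> v \<bullet> D v + e" if e: "e > 0" for e
  proof -
    have "e / (norm v)\<^sup>2 > 0" using e False by simp
    with D obtain d where d: "d > 0"
      "\<And>z. norm (z - y) < d \<Longrightarrow> norm (F z - F y - D (z - y)) \<le> e / (norm v)\<^sup>2 * norm (z - y)"
      unfolding has_derivative_at_alt by meson
    define t where "t = d / (2 * norm v)"
    have t: "t > 0" "norm (t *\<^sub>R v) < d" using d(1) False by (auto simp: t_def)
    have 1: "norm (F (y + t *\<^sub>R v) - F y - t *\<^sub>R D v) \<le> e / (norm v)\<^sup>2 * (t * norm v)"
      using d(2)[of "y + t *\<^sub>R v"] t by (simp add: scale)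
    have "v \<bullet> (F (y + t *\<^sub>R v) - F y - t *\<^sub>R D v) \<le> norm v * (e / (norm v)\<^sup>2 * (t * norm v))"
      using norm_cauchy_schwarz[of v "F (y + t *\<^sub>R v) - F y - t *\<^sub>R D v"] 1
      by (meson mult_left_mono norm_ge_zero order_trans)
    then have 2: "v \<bullet> (F (y + t *\<^sub>R v) - F y - t *\<^sub>R D v) \<le> t * e"
      using False by (simp add: power2_eq_square field_simps)
    have "t * (v \<bullet> (F (y + t *\<^sub>R v) - F y)) \<ge> t * (\<mu> * (t * (norm v)\<^sup>2))"
      using mono[of "y + t *\<^sub>R v"] t by (simp add: power2_eq_square algebra_simps)
    then have "v \<bullet> (F (y + t *\<^sub>R v) - F y) \<ge> \<mu> * (t * (norm v)\<^sup>2)" using t by simp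
    with 2 have "t * (\<mu> * (norm v)\<^sup>2) \<le> t * (v \<bullet> D v + e)"
      by (simp add: inner_diff_right algebra_simps)
    then show ?thesis using t by simp
  qed
  then show ?thesis by (rule field_le_epsilon)
qed

text \<open>The bilinear form \<open>(v, w) \<mapsto> v \<bullet> A w\<close> is a semi-inner product, and its Cauchy-Schwarz inequality
  with \<open>w = A v\<close> bounds \<open>|A v|\<^sup>2\<close> by \<open>q (v \<bullet> A v)\<close>. This replaces a diagonalisation of \<open>A\<close>.\<close>

lemma psd_contraction:
  fixes A :: "'a::real_inner \<Rightarrow> 'a"
  assumes lin: "linear A" and sym: "\<And>v w. v \<bullet> A w = w \<bullet> A v"
    and psd: "\<And>v. v \<bullet> A v \<ge> 0" and upper: "\<And>v. v \<bullet> A v \<le> q * (norm v)\<^sup>2"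
  shows "norm (A v) \<le> q * norm v"
proof -
  interpret linear A by fact
  have cs: "(w \<bullet> A v)\<^sup>2 \<le> (v \<bullet> A v) * (w \<bullet> A w)" for w
  proof -
    define a b c where "a = w \<bullet> A w" and "b = w \<bullet> A v" and "c = v \<bullet> A v"
    have quad: "0 \<le> c - 2 * t * b + t\<^sup>2 * a" for t
    proof -
      have "0 \<le> (v - t *\<^sub>R w) \<bullet> A (v - t *\<^sub>R w)" by (rule psd)
      also have "\<dots> = c - 2 * t * b + t\<^sup>2 * a"
        using sym[of v w]
        by (simp add: a_def b_def c_def diff scale inner_diff_left inner_diff_right power2_eq_square algebra_simps)
      finally show ?thesis .
    qed
    have "b\<^sup>2 \<le> c * a"
    proof (cases "a = 0")
      case True
      have "b = 0"
      proof (rule ccontr)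
        assume "b \<noteq> 0"
        \<comment> \<open>With \<open>a = 0\<close> the quadratic is affine in \<open>t\<close>; this \<open>t\<close> makes its value \<open>-1\<close>.\<close>
        then show False using quad[of "(c + 1) / (2 * b)"] True by (simp add: field_simps)
      qed
      then show ?thesis using True by simp
    next
      case False
      then have "a > 0" using psd[of w] by (simp add: a_def)
      \<comment> \<open>The minimiser of the quadratic.\<close>
      then show ?thesis using quad[of "b / a"] by (simp add: field_simps power2_eq_square)
    qed
    then show ?thesis by (simp add: a_def b_def c_def)
  qed
  show ?thesis
  proof (cases "A v = 0")
    case True
    have "q * (norm v)\<^sup>2 \<ge> 0" using psd[of v] upper[of v] by linarith
    then have "q * norm v \<ge> 0"
      by (cases "v = 0") (auto simp: zero_le_mult_iff)
    then show ?thesis using True by simp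
  next
    case False
    have "((norm (A v))\<^sup>2)\<^sup>2 = (A v \<bullet> A v)\<^sup>2" by (simp add: power2_norm_eq_inner)
    also have "\<dots> \<le> (v \<bullet> A v) * (A v \<bullet> A (A v))" by (rule cs)
    also have "\<dots> \<le> (v \<bullet> A v) * (q * (norm (A v))\<^sup>2)"
      by (intro mult_left_mono upper psd)
    finally have "(norm (A v))\<^sup>2 * (norm (A v))\<^sup>2 \<le> (q * (v \<bullet> A v)) * (norm (A v))\<^sup>2"
      by (simp add: power2_eq_square mult_ac)
    then have 1: "(norm (A v))\<^sup>2 \<le> q * (v \<bullet> A v)"
      by (rule mult_right_le_imp_le) (use False in simp)
    have q: "q \<ge> 0"
    proof (rule ccontr)
      assume "\<not> q \<ge> 0"
      have "q * (norm (A v))\<^sup>2 < 0" using \<open>\<not> q \<ge> 0\<close> False by (simp add: mult_less_0_iff)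
      then show False using psd[of "A v"] upper[of "A v"] by linarith
    qed
    have "(norm (A v))\<^sup>2 \<le> q * (q * (norm v)\<^sup>2)"
      using 1 mult_left_mono[OF upper q, of v] by linarith
    also have "\<dots> = (q * norm v)\<^sup>2" by (simp add: power2_eq_square)
    finally show ?thesis by (rule power2_le_imp_le) (use q in simp)
  qed
qed

section \<open>The reduced objective of the bilevel problem\<close>

lemma norm_fst_component_le: "norm (fst v) \<le> norm v"
  and norm_snd_component_le: "norm (snd v) \<le> norm v"
  by (metis norm_fst_le norm_snd_le prod.collapse)+

lemma matrix_inv_cancel:
  assumes "invertible A"
  shows "A ** matrix_inv A = mat 1" "matrix_inv A ** A = mat 1"
  using someI_ex[OF assms[unfolded invertible_def]] by (simp_all add: matrix_inv_def)

lemma norm_matrix_vector_le: "norm ((A :: real^'n^'m) *v v) \<le> norm A * norm v"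
proof -
  have "norm (A *v v) \<le> L2_set (\<lambda>i. norm (A $ i) * norm v) UNIV"
    unfolding norm_vec_def[of "A *v v"]
    by (rule L2_set_mono) (auto simp: matrix_vector_mul_component Cauchy_Schwarz_ineq2)
  also have "\<dots> = norm A * norm v"
    by (simp add: norm_vec_def[of A] L2_set_left_distrib)
  finally show ?thesis .
qed

lemma grad1_eq_fst_grad:
  fixes h :: "(real^'m) \<times> (real^'n) \<Rightarrow> real"
  assumes "h differentiable at z"
  shows "grad1 h z = fst (grad h z)"
proof (cases z)
  case (Pair x y)
  have "((\<lambda>x'. h (x', y)) has_derivative (\<lambda>v. (v, 0) \<bullet> grad h (x, y))) (at x)"
    by (rule has_derivative_compose[where f = "\<lambda>x'. (x', y)"])
       (use has_gradient_grad[OF assms] Pair in \<open>auto intro!: derivative_eq_intros simp: gderiv_def\<close>)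
  then have "GDERIV (\<lambda>x'. h (x', y)) x :> fst (grad h (x, y))"
    by (simp add: gderiv_def inner_prod_def)
  then show ?thesis using Pair by (simp add: grad1_def grad_eqI)
qed

lemma gderiv_grad2:
  fixes h :: "(real^'m) \<times> (real^'n) \<Rightarrow> real"
  assumes "h differentiable at (x, y)"
  shows "GDERIV (\<lambda>y'. h (x, y')) y :> snd (grad h (x, y))"
proof -
  have "((\<lambda>y'. h (x, y')) has_derivative (\<lambda>v. (0, v) \<bullet> grad h (x, y))) (at y)"
    by (rule has_derivative_compose[where f = "\<lambda>y'. (x, y')"])
       (use has_gradient_grad[OF assms] in \<open>auto intro!: derivative_eq_intros simp: gderiv_def\<close>)
  then show ?thesis by (simp add: gderiv_def inner_prod_def)
qed

lemma grad2_eq_snd_grad: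
  fixes h :: "(real^'m) \<times> (real^'n) \<Rightarrow> real"
  assumes "h differentiable at z"
  shows "grad2 h z = snd (grad h z)"
  using gderiv_grad2[of h "fst z" "snd z"] assms by (cases z) (simp add: grad2_def grad_eqI)

text \<open>If the derivative of \<open>F\<close> at a point of the graph of \<open>q\<close> vanishes on the second factor, then the
  restriction of \<open>F\<close> to the graph is differentiable there although \<open>q\<close> is only Lipschitz: the remainder
  of \<open>F\<close> stays \<open>o(|x' - x|)\<close>, and the linear part does not see the increment of \<open>q\<close>.\<close>

lemma has_derivative_along_graph:
  fixes F :: "'a::real_normed_vector \<times> 'b::real_normed_vector \<Rightarrow> 'c::real_normed_vector"
  assumes F: "(F has_derivative F') (at (x, q x))"
    and lip: "\<And>x'. norm (q x' - q x) \<le> C * norm (x' - x)" and C: "C \<ge> 0"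
    and ker: "\<And>v. F' (0, v) = 0"
  shows "((\<lambda>x'. F (x', q x')) has_derivative (\<lambda>w. F' (w, 0))) (at x)"
proof -
  interpret bounded_linear F' using F by (rule has_derivative_bounded_linear)
  have bl: "bounded_linear (\<lambda>w. F' (w, 0))"
    by (rule bounded_linear_compose[OF bounded_linear_axioms])
       (intro bounded_linear_Pair bounded_linear_ident bounded_linear_zero)
  have F'_eq: "F' (a, b) = F' (a, 0)" for a b
    using add[of "(a, 0)" "(0, b)"] ker by simp
  have "\<exists>d>0. \<forall>x'. norm (x' - x) < d \<longrightarrow>
      norm (F (x', q x') - F (x, q x) - F' (x' - x, 0)) \<le> e * norm (x' - x)" if e: "e > 0" for e
  proof -
    have C1: "1 + C > 0" using C by simp
    have "e / (1 + C) > 0" using e C1 by simp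
    with F obtain d where d: "d > 0"
      "\<And>z. norm (z - (x, q x)) < d \<Longrightarrow>
        norm (F z - F (x, q x) - F' (z - (x, q x))) \<le> e / (1 + C) * norm (z - (x, q x))"
      unfolding has_derivative_at_alt by meson
    have "norm (F (x', q x') - F (x, q x) - F' (x' - x, 0)) \<le> e * norm (x' - x)"
      if x': "norm (x' - x) < d / (1 + C)" for x'
    proof -
      have n: "norm ((x', q x') - (x, q x)) \<le> (1 + C) * norm (x' - x)"
        using norm_Pair_le[of "x' - x" "q x' - q x"] lip[of x'] by (simp add: algebra_simps)
      also have "\<dots> < d" using x' C1 by (simp add: field_simps)
      finally have "norm (F (x', q x') - F (x, q x) - F' (x' - x, q x' - q x))
          \<le> e / (1 + C) * norm ((x', q x') - (x, q x))"
        using d(2)[of "(x', q x')"] by simp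
      also have "\<dots> \<le> e / (1 + C) * ((1 + C) * norm (x' - x))"
        using n e C1 by (intro mult_left_mono) auto
      also have "\<dots> = e * norm (x' - x)" using C1 by simp
      finally show ?thesis by (simp add: F'_eq[of "x' - x" "q x' - q x"])
    qed
    then show ?thesis using d(1) C1 by (intro exI[of _ "d / (1 + C)"]) auto
  qed
  with bl show ?thesis unfolding has_derivative_at_alt by auto
qed

locale bilevel =
  fixes f g :: "(real^'m) \<times> (real^'n) \<Rightarrow> real" and \<mu> Lf0 Lf1 Lg1 Lg2 Cf0 :: real
  assumes basic: "basic_assumption f g \<mu> Lf0 Lf1 Lg1 Lg2 Cf0"
begin

abbreviation "ys \<equiv> y_star g"
abbreviation "us \<equiv> u_star f g"
abbreviation "p \<equiv> \<lambda>x. (x, ys x)"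
abbreviation "H \<equiv> hess22 g"
abbreviation "J \<equiv> jac12 g"
abbreviation "DG z \<equiv> frechet_derivative (grad g) (at z)"
abbreviation "L1 \<equiv> L1_const \<mu> Lf0 Lf1 Lg2"
abbreviation "\<kappa>g \<equiv> Lg1 / \<mu>"

lemma const_pos: "\<mu> > 0" "Lf0 > 0" "Lf1 > 0" "Lg1 > 0" "Lg2 > 0" "Cf0 > 0"
  and diff_f: "f differentiable at z" and diff_g: "g differentiable at z"
  and diff_grad_g: "grad g differentiable at z"
  and strongly_convex_g: "strongly_convex \<mu> (\<lambda>y. g (x, y))"
  and lip_grad_g: "Lg1-lipschitz_on UNIV (grad g)"
  and norm_grad2_f: "norm (grad2 f (p x)) \<le> Lf0" and norm_grad1_f: "norm (grad1 f z) \<le> Cf0"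
  using basic unfolding basic_assumption_def by blast+

lemma lip_hess: "norm (H z - H z') \<le> Lg2 * norm (z - z')"
  and lip_jac: "norm (J z - J z') \<le> Lg2 * norm (z - z')"
  and lip_grad_f: "norm (grad f z - grad f z') \<le> Lf1 * norm (z - z')"
  and lip_grad_g': "norm (grad g z - grad g z') \<le> Lg1 * norm (z - z')"
  using basic unfolding basic_assumption_def by (auto dest!: lipschitz_onD simp: dist_norm)

lemma lip_grad1_f: "norm (grad1 f z - grad1 f z') \<le> Lf1 * norm (z - z')"
  using order_trans[OF norm_fst_component_le lip_grad_f[of z z']]
  by (simp add: grad1_eq_fst_grad[OF diff_f])

lemma lip_grad2_f: "norm (grad2 f z - grad2 f z') \<le> Lf1 * norm (z - z')"
  using order_trans[OF norm_snd_component_le lip_grad_f[of z z']]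
  by (simp add: grad2_eq_snd_grad[OF diff_f])

lemma lip_grad2_g: "norm (grad2 g z - grad2 g z') \<le> Lg1 * norm (z - z')"
  using order_trans[OF norm_snd_component_le lip_grad_g'[of z z']]
  by (simp add: grad2_eq_snd_grad[OF diff_g])

lemma L1_pos: "L1 > 0"
  using const_pos by (simp add: L1_const_def add_pos_pos)

lemma has_derivative_grad_g: "(grad g has_derivative DG z) (at z)"
  using diff_grad_g frechet_derivative_works by blast

lemma has_derivative_grad_g_section:
  "((\<lambda>y'. grad g (x, y')) has_derivative (\<lambda>k. DG (x, y) (0, k))) (at y)"
  by (rule has_derivative_compose[where f = "\<lambda>y'. (x, y')", OF _ has_derivative_grad_g])
     (auto intro!: derivative_eq_intros)

text \<open>Both blocks of second derivatives are components of the one derivative of \<open>grad g\<close>, so symmetry and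
  norm bounds can be read off from there.\<close>

lemma hess22_vec: "H z *v k = snd (DG z (0, k))"
proof (cases z)
  case (Pair x y)
  have "((\<lambda>y'. grad2 g (x, y')) has_derivative (\<lambda>k. snd (DG (x, y) (0, k)))) (at y)"
    unfolding grad2_eq_snd_grad[OF diff_g]
    by (rule has_derivative_snd[OF has_derivative_grad_g_section])
  moreover from this have "((\<lambda>y'. grad2 g (x, y')) has_derivative (\<lambda>k. H (x, y) *v k)) (at y)"
    unfolding hess22_def prod.case jacobian_works[symmetric] by (rule differentiableI)
  ultimately have "(\<lambda>k. H (x, y) *v k) = (\<lambda>k. snd (DG (x, y) (0, k)))"
    using has_derivative_unique by blast
  then show ?thesis using Pair by metis
qed

lemma jac12_vec: "J z *v k = fst (DG z (0, k))"
proof (cases z)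
  case (Pair x y)
  have "((\<lambda>y'. grad1 g (x, y')) has_derivative (\<lambda>k. fst (DG (x, y) (0, k)))) (at y)"
    unfolding grad1_eq_fst_grad[OF diff_g]
    by (rule has_derivative_fst[OF has_derivative_grad_g_section])
  moreover from this have "((\<lambda>y'. grad1 g (x, y')) has_derivative (\<lambda>k. J (x, y) *v k)) (at y)"
    unfolding jac12_def prod.case jacobian_works[symmetric] by (rule differentiableI)
  ultimately have "(\<lambda>k. J (x, y) *v k) = (\<lambda>k. fst (DG (x, y) (0, k)))"
    using has_derivative_unique by blast
  then show ?thesis using Pair by metis
qed

lemma has_derivative_grad2_g:
  "((\<lambda>y'. grad2 g (x, y')) has_derivative (\<lambda>k. H (x, y) *v k)) (at y)"
  unfolding grad2_eq_snd_grad[OF diff_g] hess22_vec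
  by (rule has_derivative_snd[OF has_derivative_grad_g_section])

lemma DG_symmetric: "w \<bullet> DG z v = v \<bullet> DG z w"
  by (rule second_derivative_symmetric[OF has_gradient_grad[OF diff_g] has_derivative_grad_g])

lemma norm_DG_le: "norm (DG z w) \<le> Lg1 * norm w"
  by (rule derivative_norm_le_lipschitz[OF has_derivative_grad_g lip_grad_g])

lemma hess_symmetric: "v \<bullet> (H z *v w) = w \<bullet> (H z *v v)"
  using DG_symmetric[of "(0, v)" z "(0, w)"] by (simp add: hess22_vec inner_prod_def)

lemma norm_hess_vec_le: "norm (H z *v v) \<le> Lg1 * norm v"
  using order_trans[OF norm_snd_component_le norm_DG_le[of z "(0, v)"]]
  by (simp add: hess22_vec norm_Pair)

lemma norm_jac_vec_le: "norm (J z *v v) \<le> Lg1 * norm v"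
  using order_trans[OF norm_fst_component_le norm_DG_le[of z "(0, v)"]]
  by (simp add: jac12_vec norm_Pair)

lemma grad2_g_strongly_monotone:
  "(y' - y) \<bullet> (grad2 g (x, y') - grad2 g (x, y)) \<ge> \<mu> * (norm (y' - y))\<^sup>2"
  using strongly_convex_strongly_monotone[OF strongly_convex_g gderiv_grad2[OF diff_g] gderiv_grad2[OF diff_g]]
  by (simp add: grad2_eq_snd_grad[OF diff_g])

lemma hess_lower: "v \<bullet> (H z *v v) \<ge> \<mu> * (norm v)\<^sup>2"
  using derivative_strongly_monotone[OF has_derivative_grad2_g grad2_g_strongly_monotone]
  by (cases z) auto

lemma norm_hess_vec_ge: "\<mu> * norm v \<le> norm (H z *v v)"
proof (cases "v = 0")
  case False
  have "norm v * (\<mu> * norm v) \<le> norm v * norm (H z *v v)"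
    using order_trans[OF hess_lower norm_cauchy_schwarz, of v z] by (simp add: power2_eq_square mult_ac)
  then show ?thesis using False by simp
qed simp

lemma mu_le_Lg1: "\<mu> \<le> Lg1"
  using norm_hess_vec_ge[of "axis undefined 1"] norm_hess_vec_le[of undefined "axis undefined 1"]
  by (smt (verit) mult_cancel_left2 norm_axis_1 norm_hess_vec_ge)

lemma kg_ge_1: "\<kappa>g \<ge> 1"
  using mu_le_Lg1 const_pos by simp

lemma invertible_hess: "invertible (H z)"
proof -
  have "v = 0" if "H z *v v = 0" for v
    using norm_hess_vec_ge[of v z] that const_pos(1) by (simp add: mult_le_0_iff)
  then have "inj ((*v) (H z))"
    by (simp add: linear_injective_0)
  then show ?thesis
    by (simp add: invertible_left_inverse matrix_left_invertible_injective)
qed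

lemma hess_inv_vec: "H z *v (matrix_inv (H z) *v b) = b"
  by (simp add: matrix_vector_mul_assoc matrix_inv_cancel(1)[OF invertible_hess])

lemma inv_hess_vec: "matrix_inv (H z) *v (H z *v b) = b"
  by (simp add: matrix_vector_mul_assoc matrix_inv_cancel(2)[OF invertible_hess])

lemma norm_inv_hess_vec_le: "norm (matrix_inv (H z) *v b) \<le> norm b / \<mu>"
  using norm_hess_vec_ge[of "matrix_inv (H z) *v b" z] const_pos(1)
  by (simp add: hess_inv_vec field_simps)

lemma y_star_min: "g (x, ys x) \<le> g (x, y)"
proof -
  have "\<exists>y. \<forall>z. g (x, y) \<le> g (x, z)"
  proof (rule strongly_convex_attains_min[OF strongly_convex_g const_pos(1)])
    show "(\<lambda>y. g (x, y)) differentiable at y" for y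
      using gderiv_grad2[OF diff_g] by (auto simp: gderiv_def differentiable_def)
  qed
  then obtain y0 where y0: "\<And>z. g (x, y0) \<le> g (x, z)" by blast
  have "g (x, ys x) = g (x, y0)"
    unfolding y_star_def by (rule arg_min_equality[where f = "\<lambda>y. g (x, y)"]) (auto intro: y0)
  then show ?thesis using y0 by simp
qed

lemma grad2_g_y_star: "grad2 g (p x) = 0"
proof -
  have "((\<lambda>y'. g (x, y')) has_derivative (\<lambda>h. h \<bullet> grad2 g (p x))) (at (ys x))"
    using gderiv_grad2[OF diff_g] by (simp add: gderiv_def grad2_eq_snd_grad[OF diff_g])
  then have "(\<lambda>h. h \<bullet> grad2 g (p x)) = (\<lambda>v. 0)"
    by (rule differential_zero_maxmin[OF UNIV_I open_UNIV]) (auto intro: y_star_min)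
  then show ?thesis by (metis inner_eq_zero_iff)
qed

text \<open>The lower-level gradient vanishes on the graph of \<open>y_star\<close>. Moving \<open>x\<close> alone changes it by at most
  \<open>Lg1 |x - x'|\<close>, and strong monotonicity turns this into a bound on the distance of the minimisers.\<close>

lemma lip_y_star: "norm (ys x - ys x') \<le> \<kappa>g * norm (x - x')"
proof (cases "ys x = ys x'")
  case True
  then show ?thesis using const_pos by simp
next
  case False
  let ?n = "norm (ys x - ys x')"
  have "?n * (\<mu> * ?n) \<le> (ys x - ys x') \<bullet> (grad2 g (x', ys x) - grad2 g (p x'))"
    using grad2_g_strongly_monotone[of "ys x" "ys x'" x'] by (simp add: power2_eq_square mult_ac)
  also have "\<dots> = (ys x - ys x') \<bullet> (grad2 g (x', ys x) - grad2 g (p x))"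
    by (simp add: grad2_g_y_star)
  also have "\<dots> \<le> ?n * norm (grad2 g (x', ys x) - grad2 g (p x))"
    by (rule norm_cauchy_schwarz)
  also have "\<dots> \<le> ?n * (Lg1 * norm (x - x'))"
    using lip_grad2_g[of "(x', ys x)" "p x"]
    by (intro mult_left_mono) (auto simp: norm_Pair norm_minus_commute)
  finally show ?thesis using False const_pos(1) by (simp add: field_simps)
qed

lemma lip_p: "norm (p x - p x') \<le> (1 + \<kappa>g) * norm (x - x')"
  using norm_Pair_le[of "x - x'" "ys x - ys x'"] lip_y_star[of x x'] by (simp add: algebra_simps)

lemma hess_u_star: "H (p x) *v us x = grad2 f (p x)"
  by (simp add: u_star_def hess_inv_vec)

lemma norm_u_star: "norm (us x) \<le> Lf0 / \<mu>"
  unfolding u_star_def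
  by (rule order_trans[OF norm_inv_hess_vec_le divide_right_mono[OF norm_grad2_f]])
     (use const_pos in simp)

text \<open>\<open>us x\<close> solves the linear system \<open>H u = grad2 f\<close> at the point \<open>p x\<close>. As an approximate solution of the
  system at \<open>z\<close> its residual is at most \<open>(Lf1 + Lg2 Lf0 / \<mu>) |z - p x|\<close>, which is where the constant \<open>L1\<close>
  comes from.\<close>

lemma linear_system_perturbation:
  "norm (matrix_inv (H z) *v grad2 f z - us x) \<le> L1 / \<mu> * norm (z - p x)"
proof -
  have "matrix_inv (H z) *v grad2 f z - us x = matrix_inv (H z) *v (grad2 f z - H z *v us x)"
    by (simp add: matrix_vector_mult_diff_distrib inv_hess_vec)
  also have "grad2 f z - H z *v us x = (grad2 f z - grad2 f (p x)) - (H z - H (p x)) *v us x"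
    by (simp add: matrix_vector_mult_diff_rdistrib hess_u_star)
  finally have "norm (matrix_inv (H z) *v grad2 f z - us x)
      \<le> norm ((grad2 f z - grad2 f (p x)) - (H z - H (p x)) *v us x) / \<mu>"
    by (metis norm_inv_hess_vec_le)
  also have "\<dots> \<le> (Lf1 * norm (z - p x) + Lg2 * norm (z - p x) * (Lf0 / \<mu>)) / \<mu>"
  proof -
    have "norm ((H z - H (p x)) *v us x) \<le> Lg2 * norm (z - p x) * (Lf0 / \<mu>)"
      by (rule order_trans[OF norm_matrix_vector_le mult_mono[OF lip_hess norm_u_star]])
         (use const_pos in auto)
    then show ?thesis
      using lip_grad2_f[of z "p x"] const_pos(1)
        norm_triangle_ineq4[of "grad2 f z - grad2 f (p x)" "(H z - H (p x)) *v us x"]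
      by (intro divide_right_mono) auto
  qed
  also have "\<dots> = L1 / \<mu> * norm (z - p x)"
    by (simp add: L1_const_def algebra_simps add_divide_distrib)
  finally show ?thesis .
qed

lemma lip_u_star: "norm (us x - us x') \<le> L1 / \<mu> * (1 + \<kappa>g) * norm (x - x')"
proof -
  have "norm (us x - us x') \<le> L1 / \<mu> * norm (p x - p x')"
    using linear_system_perturbation[of "p x" x'] by (simp add: u_star_def)
  also have "\<dots> \<le> L1 / \<mu> * ((1 + \<kappa>g) * norm (x - x'))"
    using lip_p L1_pos const_pos by (intro mult_left_mono) auto
  finally show ?thesis by simp
qed

lemma norm_jac_diff_u_star_le: "norm ((J z - J z') *v us x) \<le> Lg2 * norm (z - z') * (Lf0 / \<mu>)"
  by (rule order_trans[OF norm_matrix_vector_le mult_mono[OF lip_jac norm_u_star]])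
     (use const_pos in auto)

text \<open>The hypergradient; it is the gradient of \<open>Phi f g\<close> by the lemma \<open>gderiv_Phi\<close> below.\<close>

definition dPhi :: "real^'m \<Rightarrow> real^'m" where
  "dPhi x = grad1 f (p x) - J (p x) *v us x"

lemma hypergradient_error:
  "norm (grad1 f (x, y) - J (x, y) *v u - dPhi x)
    \<le> L1 * norm (y - ys x) + Lg1 * norm (u - us x)"
proof -
  have "norm (grad1 f (x, y) - grad1 f (p x)) \<le> Lf1 * norm (y - ys x)"
    using lip_grad1_f[of "(x, y)" "p x"] by (simp add: norm_Pair)
  moreover have "norm ((J (x, y) - J (p x)) *v us x) \<le> Lg2 * norm (y - ys x) * (Lf0 / \<mu>)"
    using norm_jac_diff_u_star_le[of "(x, y)" "p x" x] by (simp add: norm_Pair)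
  moreover note norm_jac_vec_le[of "(x, y)" "u - us x"]
  moreover have "grad1 f (x, y) - J (x, y) *v u - dPhi x = (grad1 f (x, y) - grad1 f (p x))
      - (J (x, y) - J (p x)) *v us x - J (x, y) *v (u - us x)"
    by (simp add: dPhi_def matrix_vector_mult_diff_distrib matrix_vector_mult_diff_rdistrib)
  moreover have "norm ((a::real^'m) - b - c) \<le> norm a + norm b + norm c" for a b c
    by (meson add_right_mono norm_triangle_ineq4 order_trans)
  ultimately have "norm (grad1 f (x, y) - J (x, y) *v u - dPhi x) \<le> Lf1 * norm (y - ys x)
      + Lg2 * norm (y - ys x) * (Lf0 / \<mu>) + Lg1 * norm (u - us x)"
    by (smt (verit, best))
  then show ?thesis by (simp add: L1_const_def algebra_simps)
qed

text \<open>The two increments of \<open>grad1 f\<close> and \<open>J\<close> contribute \<open>L1 |p x - p x'|\<close>, the increment of \<open>us\<close>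
  contributes \<open>\<kappa>g L1 |p x - p x'|\<close>, and \<open>p\<close> itself has Lipschitz constant \<open>1 + \<kappa>g\<close>.\<close>

lemma lip_dPhi: "norm (dPhi x - dPhi x') \<le> L1 * (1 + \<kappa>g)\<^sup>2 * norm (x - x')"
proof -
  let ?P = "norm (p x - p x')"
  have "norm (grad1 f (p x) - grad1 f (p x')) \<le> Lf1 * ?P" by (rule lip_grad1_f)
  moreover have "norm ((J (p x) - J (p x')) *v us x') \<le> Lg2 * ?P * (Lf0 / \<mu>)"
    by (rule norm_jac_diff_u_star_le)
  moreover have "norm (J (p x) *v (us x - us x')) \<le> Lg1 * (L1 / \<mu> * ?P)"
    using linear_system_perturbation[of "p x" x'] const_pos
    by (intro order_trans[OF norm_jac_vec_le] mult_left_mono) (auto simp: u_star_def)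
  moreover have "dPhi x - dPhi x' = (grad1 f (p x) - grad1 f (p x'))
      - (J (p x) - J (p x')) *v us x' - J (p x) *v (us x - us x')"
    by (simp add: dPhi_def matrix_vector_mult_diff_distrib matrix_vector_mult_diff_rdistrib)
  moreover have "norm ((a::real^'m) - b - c) \<le> norm a + norm b + norm c" for a b c
    by (meson add_right_mono norm_triangle_ineq4 order_trans)
  ultimately have "norm (dPhi x - dPhi x')
      \<le> Lf1 * ?P + Lg2 * ?P * (Lf0 / \<mu>) + Lg1 * (L1 / \<mu> * ?P)"
    by (smt (verit, best))
  also have "\<dots> = L1 * (1 + \<kappa>g) * ?P"
    by (simp add: L1_const_def algebra_simps add_divide_distrib)
  also have "\<dots> \<le> L1 * (1 + \<kappa>g) * ((1 + \<kappa>g) * norm (x - x'))"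
    using lip_p L1_pos kg_ge_1 by (intro mult_left_mono) auto
  finally show ?thesis by (simp add: power2_eq_square mult_ac)
qed

text \<open>On the graph of \<open>y_star\<close> the lower-level gradient is zero, so \<open>Phi f g\<close> is the restriction to the graph
  of \<open>F(z) = f(z) - grad2 g(z) \<bullet> u\<close> for every fixed \<open>u\<close>. For \<open>u = us x\<close> the derivative of \<open>F\<close> in the second
  variable is \<open>grad2 f - H u = 0\<close>, where the symmetry of the second derivative of \<open>g\<close> enters, and
  differentiation along the graph applies: \<open>us x\<close> is the Lagrange multiplier of the optimality
  condition of the lower level, and of \<open>y_star\<close> only the Lipschitz continuity is used.\<close>

lemma gderiv_Phi: "GDERIV (Phi f g) x :> dPhi x"
proof -
  define F where "F z = f z - grad g z \<bullet> (0, us x)" for z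
  have dF: "(F has_derivative (\<lambda>w. w \<bullet> grad f (p x) - DG (p x) w \<bullet> (0, us x))) (at (p x))"
    unfolding F_def
    by (intro has_derivative_diff has_derivative_inner_left has_derivative_grad_g
        has_gradient_grad[OF diff_f, unfolded gderiv_def])
  have eq: "w \<bullet> grad f (p x) - DG (p x) w \<bullet> (0, us x) = w \<bullet> (dPhi x, 0)" for w
  proof -
    have "DG (p x) w \<bullet> (0, us x) = w \<bullet> DG (p x) (0, us x)"
      by (metis DG_symmetric inner_commute)
    also have "DG (p x) (0, us x) = (J (p x) *v us x, grad2 f (p x))"
      by (simp add: jac12_vec hess_u_star[symmetric] hess22_vec)
    finally show ?thesis
      by (cases w) (simp add: inner_prod_def dPhi_def inner_diff_right
          grad1_eq_fst_grad[OF diff_f] grad2_eq_snd_grad[OF diff_f])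
  qed
  have "((\<lambda>x'. F (p x')) has_derivative (\<lambda>w. (w, 0 :: real^'n) \<bullet> (dPhi x, 0))) (at x)"
  proof (rule has_derivative_along_graph[where F = F and q = ys and C = \<kappa>g
        and F' = "\<lambda>w. w \<bullet> (dPhi x, 0)"])
    show "(F has_derivative (\<lambda>w. w \<bullet> (dPhi x, 0))) (at (p x))"
      using dF unfolding eq .
  qed (use lip_y_star const_pos in \<open>auto simp: inner_prod_def\<close>)
  moreover have "F (p x') = Phi f g x'" for x'
    using grad2_g_y_star[of x'] by (simp add: F_def Phi_def inner_prod_def grad2_eq_snd_grad[OF diff_g])
  ultimately show ?thesis by (simp add: gderiv_def inner_prod_def)
qed

lemma grad_Phi: "grad (Phi f g) x = dPhi x"
  by (rule grad_eqI[OF gderiv_Phi])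

end

section \<open>One step of the algorithm\<close>

lemma inner_loop_cost [simp]:
  "grads (inner_loop g \<gamma> z d N) = 0" "jvps (inner_loop g \<gamma> z d N) = 0" "hvps (inner_loop g \<gamma> z d N) = N"
  by (induction N) (simp_all add: pure_def bind_counted_def hvp_def Let_def)

lemma result_inner_loop_Suc:
  "result (inner_loop g \<gamma> z d (Suc N)) =
     (let v = result (inner_loop g \<gamma> z d N) in v - \<gamma> *\<^sub>R (hess22 g z *v v) + \<gamma> *\<^sub>R d)"
  by (simp add: pure_def bind_counted_def hvp_def Let_def)

lemma nbo_step_cost:
  "grads (nbo_step f g T \<alpha> \<gamma> s) = 3" "jvps (nbo_step f g T \<alpha> \<gamma> s) = 1"
  "hvps (nbo_step f g T \<alpha> \<gamma> s) = 2 * T + 3"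
  by (cases s, simp add: nbo_step_def pure_def bind_counted_def hvp_def jvp_def eval_grad1_def
      eval_grad2_def Let_def del: inner_loop.simps)+

lemma nbo_gd_cost:
  "grads (nbo_gd f g T \<alpha>s \<gamma>s s K) = 3 * K" "jvps (nbo_gd f g T \<alpha>s \<gamma>s s K) = K"
  "hvps (nbo_gd f g T \<alpha>s \<gamma>s s K) = (2 * T + 3) * K"
  by (induction K) (simp_all add: nbo_step_cost pure_def bind_counted_def Let_def algebra_simps)

lemma result_nbo_step:
  "result (nbo_step f g T \<alpha> \<gamma> (y, u, x)) =
     (y - result (inner_loop g \<gamma> (x, y) (grad2 g (x, y)) (Suc T)),
      u - result (inner_loop g \<gamma> (x, y) (hess22 g (x, y) *v u - grad2 f (x, y)) (Suc T)),
      x - \<alpha> *\<^sub>R (grad1 f (x, y) - jac12 g (x, y) *v u))"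
  by (simp add: nbo_step_def pure_def bind_counted_def hvp_def jvp_def eval_grad1_def
      eval_grad2_def Let_def del: inner_loop.simps)

context bilevel
begin

text \<open>\<open>H\<^sup>-\<^sup>1 d\<close> is the fixed point of the inner iteration, the error is multiplied by \<open>I - \<gamma> H\<close> in every
  update, and the iteration starts from \<open>0\<close>.\<close>

lemma inner_loop_error:
  assumes \<gamma>: "0 < \<gamma>" "\<gamma> \<le> 1 / Lg1"
  shows "norm (matrix_inv (H z) *v d - result (inner_loop g \<gamma> z d N))
      \<le> (1 - \<gamma> * \<mu>) ^ N * norm (matrix_inv (H z) *v d)"
proof (induction N)
  case 0
  then show ?case by (simp add: pure_def)
next
  case (Suc N)
  define A where "A v = v - \<gamma> *\<^sub>R (H z *v v)" for v
  have \<gamma>L: "\<gamma> * Lg1 \<le> 1" using \<gamma> const_pos by (simp add: field_simps)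
  have contr: "norm (A v) \<le> (1 - \<gamma> * \<mu>) * norm v" for v
  proof (rule psd_contraction)
    show "linear A" unfolding A_def
      by (intro linear_compose_sub linear_ident linear_compose_scale_right matrix_vector_mul_linear)
    show "v \<bullet> A w = w \<bullet> A v" for v w
      by (simp add: A_def inner_diff_right hess_symmetric[of v z w] inner_commute[of v w])
    show "0 \<le> v \<bullet> A v" for v
    proof -
      have "v \<bullet> (H z *v v) \<le> norm v * (Lg1 * norm v)"
        by (rule order_trans[OF norm_cauchy_schwarz mult_left_mono[OF norm_hess_vec_le]]) simp
      then have "\<gamma> * (v \<bullet> (H z *v v)) \<le> \<gamma> * (norm v * (Lg1 * norm v))"
        using \<gamma> by (intro mult_left_mono) auto
      also have "\<dots> \<le> 1 * (norm v)\<^sup>2"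
        using mult_right_mono[OF \<gamma>L, of "(norm v)\<^sup>2"] by (simp add: power2_eq_square mult_ac)
      finally show ?thesis by (simp add: A_def inner_diff_right power2_norm_eq_inner)
    qed
    show "v \<bullet> A v \<le> (1 - \<gamma> * \<mu>) * (norm v)\<^sup>2" for v
      using mult_left_mono[OF hess_lower[of v z], of \<gamma>] \<gamma>
      by (simp add: A_def inner_diff_right power2_norm_eq_inner algebra_simps)
  qed
  let ?b = "matrix_inv (H z) *v d" and ?v = "result (inner_loop g \<gamma> z d N)"
  have "?b - result (inner_loop g \<gamma> z d (Suc N)) = A (?b - ?v)"
    by (simp add: result_inner_loop_Suc Let_def A_def matrix_vector_mult_diff_distrib hess_inv_vec
        scaleR_diff_right algebra_simps del: inner_loop.simps)
  moreover have "0 \<le> 1 - \<gamma> * \<mu>"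
    using mult_left_mono[OF mu_le_Lg1, of \<gamma>] \<gamma> \<gamma>L by linarith
  ultimately show ?case
    using contr[of "?b - ?v"] mult_left_mono[OF Suc.IH, of "1 - \<gamma> * \<mu>"]
    by (simp add: mult_ac del: inner_loop.simps)
qed

text \<open>The error of an exact Newton step for \<open>grad2 g (x, \<cdot>) = 0\<close> is \<open>H\<^sup>-\<^sup>1\<close> applied to the error, at the
  minimiser, of the linearisation of \<open>grad2 g\<close> at \<open>y\<close>.\<close>

lemma newton_step_error:
  "norm (y - matrix_inv (H (x, y)) *v grad2 g (x, y) - ys x) \<le> Lg2 / \<mu> * (norm (y - ys x))\<^sup>2"
proof -
  let ?e = "norm (y - ys x)"
  have "norm (grad2 g (x, ys x) - grad2 g (x, y) - H (x, y) *v (ys x - y)) \<le> norm (ys x - y) * (Lg2 * ?e)"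
  proof (rule differentiable_bound_linearization[where S = "cball y ?e" and f = "\<lambda>y'. grad2 g (x, y')"
        and f' = "\<lambda>y' k. H (x, y') *v k"])
    show "y + t *\<^sub>R (ys x - y) \<in> cball y ?e" if "t \<in> {0..1}" for t
      using that by (simp add: dist_norm norm_minus_commute[of "ys x"] mult_left_le_one_le)
    show "((\<lambda>y'. grad2 g (x, y')) has_derivative (*v) (H (x, y'))) (at y' within cball y ?e)" for y'
      by (rule has_derivative_at_withinI[OF has_derivative_grad2_g])
    show "onorm ((*v) (H (x, y')) - (*v) (H (x, y))) \<le> Lg2 * ?e" if "y' \<in> cball y ?e" for y'
    proof (rule onorm_le)
      fix k
      have "norm (((*v) (H (x, y')) - (*v) (H (x, y))) k) = norm ((H (x, y') - H (x, y)) *v k)"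
        by (simp add: matrix_vector_mult_diff_rdistrib)
      also have "\<dots> \<le> norm (H (x, y') - H (x, y)) * norm k" by (rule norm_matrix_vector_le)
      also have "\<dots> \<le> (Lg2 * ?e) * norm k"
      proof (rule mult_right_mono)
        have "norm (y' - y) \<le> ?e" using that by (simp add: dist_norm norm_minus_commute)
        then show "norm (H (x, y') - H (x, y)) \<le> Lg2 * ?e"
          using order_trans[OF lip_hess[of "(x, y')" "(x, y)"]] const_pos by (simp add: norm_Pair)
      qed simp
      finally show "norm (((*v) (H (x, y')) - (*v) (H (x, y))) k) \<le> Lg2 * ?e * norm k" .
    qed
  qed simp
  then have 1: "norm (H (x, y) *v (y - ys x) - grad2 g (x, y)) \<le> Lg2 * ?e\<^sup>2"
    by (simp add: grad2_g_y_star matrix_vector_mult_diff_distrib norm_minus_commute power2_eq_square algebra_simps)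
  have "y - matrix_inv (H (x, y)) *v grad2 g (x, y) - ys x
      = matrix_inv (H (x, y)) *v (H (x, y) *v (y - ys x) - grad2 g (x, y))"
    by (simp add: matrix_vector_mult_diff_distrib inv_hess_vec)
  then show ?thesis
    using order_trans[OF norm_inv_hess_vec_le divide_right_mono[OF 1]] const_pos by simp
qed

text \<open>In the region \<open>|y - ys x| \<le> \<mu> / (2 Lg2)\<close> the exact Newton step halves the error \<open>e\<close>. The Newton
  direction has length at most \<open>3 e / 2\<close>, and solving for it with relative accuracy \<open>1 / 6\<close> costs a further
  \<open>e / 4\<close>. A fixed relative accuracy is enough, which is why a number of inner iterations proportional to
  the condition number suffices, without a logarithm.\<close>

lemma inexact_newton_y:
  assumes \<gamma>: "0 < \<gamma>" "\<gamma> \<le> 1 / Lg1" and \<rho>: "(1 - \<gamma> * \<mu>) ^ N \<le> 1 / 6"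
    and close: "norm (y - ys x) \<le> \<mu> / (2 * Lg2)"
  shows "norm (y - result (inner_loop g \<gamma> (x, y) (grad2 g (x, y)) N) - ys x) \<le> 3 / 4 * norm (y - ys x)"
proof -
  let ?e = "norm (y - ys x)" and ?b = "matrix_inv (H (x, y)) *v grad2 g (x, y)"
  let ?v = "result (inner_loop g \<gamma> (x, y) (grad2 g (x, y)) N)"
  have "Lg2 / \<mu> * ?e \<le> 1 / 2"
    using close const_pos by (simp add: field_simps)
  then have "Lg2 / \<mu> * ?e\<^sup>2 \<le> 1 / 2 * ?e"
    using mult_right_mono[of "Lg2 / \<mu> * ?e" "1 / 2" ?e] by (simp add: power2_eq_square)
  then have N: "norm (y - ?b - ys x) \<le> 1 / 2 * ?e"
    using newton_step_error[of y x] by linarith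
  have "?b = (y - ys x) - (y - ?b - ys x)" by simp
  then have b: "norm ?b \<le> 3 / 2 * ?e"
    using N norm_triangle_ineq4[of "y - ys x" "y - ?b - ys x"] by simp
  have "norm (?b - ?v) \<le> 1 / 6 * norm ?b"
    by (rule order_trans[OF inner_loop_error[OF \<gamma>] mult_right_mono[OF \<rho>]]) simp
  moreover have eq: "y - ?v - ys x = (y - ?b - ys x) + (?b - ?v)" by simp
  have "norm (y - ?v - ys x) \<le> norm (y - ?b - ys x) + norm (?b - ?v)"
    by (subst eq) (rule norm_triangle_ineq)
  ultimately show ?thesis using N b by linarith
qed

text \<open>The system for \<open>u\<close> is linear, so an exact Newton step solves it up to the error of taking its data
  at \<open>(x, y)\<close> instead of \<open>p x\<close>; the previous error of \<open>u\<close> enters through the inner accuracy alone.\<close>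

lemma inexact_newton_u:
  assumes \<gamma>: "0 < \<gamma>" "\<gamma> \<le> 1 / Lg1" and \<rho>: "(1 - \<gamma> * \<mu>) ^ N \<le> 1 / 6"
  shows "norm (u - result (inner_loop g \<gamma> (x, y) (H (x, y) *v u - grad2 f (x, y)) N) - us x)
    \<le> 1 / 6 * norm (u - us x) + 7 / 6 * (L1 / \<mu> * norm (y - ys x))"
proof -
  let ?d = "H (x, y) *v u - grad2 f (x, y)"
  let ?b = "matrix_inv (H (x, y)) *v ?d" and ?w = "result (inner_loop g \<gamma> (x, y) ?d N)"
  let ?s = "matrix_inv (H (x, y)) *v grad2 f (x, y)"
  have b: "?b = u - ?s" by (simp add: matrix_vector_mult_diff_distrib inv_hess_vec)
  have s: "norm (?s - us x) \<le> L1 / \<mu> * norm (y - ys x)"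
    using linear_system_perturbation[of "(x, y)" x] by (simp add: norm_Pair)
  have "?b = (u - us x) - (?s - us x)" by (simp add: b)
  then have "norm ?b \<le> norm (u - us x) + L1 / \<mu> * norm (y - ys x)"
    using s norm_triangle_ineq4[of "u - us x" "?s - us x"] by simp
  moreover have "norm (?b - ?w) \<le> 1 / 6 * norm ?b"
    by (rule order_trans[OF inner_loop_error[OF \<gamma>] mult_right_mono[OF \<rho>]]) simp
  moreover have "norm (u - ?w - us x) \<le> norm (?s - us x) + norm (?b - ?w)"
    by (rule order_trans[OF _ norm_triangle_ineq]) (simp add: b)
  ultimately show ?thesis using s by linarith
qed

end

section \<open>Decrease of a potential along the iteration\<close>

text \<open>The smallness conditions on the step size are stated in the form in which they are used:
  \<open>\<alpha>_smooth\<close> compares \<open>\<alpha>\<close> with the Lipschitz constant of the hypergradient, and \<open>\<alpha>_drift\<close> makes the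
  displacement of \<open>y_star\<close> in one step, which is at most \<open>\<alpha> \<kappa>g |dx|\<close>, small compared with the region of
  fast convergence of Newton's method.\<close>

locale nbo_run = bilevel f g \<mu> Lf0 Lf1 Lg1 Lg2 Cf0
  for f g :: "(real^'m) \<times> (real^'n) \<Rightarrow> real" and \<mu> Lf0 Lf1 Lg1 Lg2 Cf0 :: real +
  fixes \<gamma> \<alpha> :: real and T :: nat and y0 u0 :: "real^'n" and x0 :: "real^'m"
  assumes \<gamma>: "0 < \<gamma>" "\<gamma> \<le> 1 / Lg1"
    and inner_accuracy: "(1 - \<gamma> * \<mu>) ^ Suc T \<le> 1 / 6"
    and \<alpha>_pos: "0 < \<alpha>"
    and \<alpha>_smooth: "\<alpha> * (L1_const \<mu> Lf0 Lf1 Lg2 * (1 + Lg1 / \<mu>)\<^sup>2) \<le> 1 / 40"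
    and \<alpha>_drift: "\<alpha> * (Cf0 + Lg1 * (Lf0 / \<mu> + 5 * L1_const \<mu> Lf0 Lf1 Lg2 / (2 * Lg2))) * (Lg1 / \<mu>)
        \<le> \<mu> / (8 * Lg2)"
    and init: "good_init f g \<mu> Lf0 Lf1 Lg2 y0 u0 x0"
begin

definition "state k = result (nbo_gd f g T (\<lambda>_. \<alpha>) (\<lambda>_. \<gamma>) (y0, u0, x0) k)"
abbreviation "Y k \<equiv> fst (state k)"
abbreviation "U k \<equiv> fst (snd (state k))"
abbreviation "X k \<equiv> snd (snd (state k))"
abbreviation "dx k \<equiv> grad1 f (X k, Y k) - J (X k, Y k) *v U k"
abbreviation "eY k \<equiv> norm (Y k - ys (X k))"
abbreviation "eU k \<equiv> norm (U k - us (X k))"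

lemma state_0: "Y 0 = y0" "U 0 = u0" "X 0 = x0"
  by (simp_all add: state_def pure_def)

lemma state_Suc_result: "state (Suc k) = result (nbo_step f g T \<alpha> \<gamma> (Y k, U k, X k))"
  by (simp add: state_def bind_counted_def Let_def)

lemma X_Suc: "X (Suc k) = X k - \<alpha> *\<^sub>R dx k"
  unfolding state_Suc_result result_nbo_step by simp

lemma norm_X_Suc: "norm (X k - X (Suc k)) = \<alpha> * norm (dx k)"
  using \<alpha>_pos by (simp add: X_Suc)

lemma eY_Suc:
  assumes "eY k \<le> \<mu> / (2 * Lg2)"
  shows "eY (Suc k) \<le> 3 / 4 * eY k + \<kappa>g * \<alpha> * norm (dx k)"
proof -
  have "norm (Y (Suc k) - ys (X k)) \<le> 3 / 4 * eY k"
    using inexact_newton_y[OF \<gamma> inner_accuracy assms]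
    unfolding state_Suc_result result_nbo_step by simp
  moreover have "norm (ys (X k) - ys (X (Suc k))) \<le> \<kappa>g * \<alpha> * norm (dx k)"
    using lip_y_star[of "X k" "X (Suc k)"] unfolding norm_X_Suc by (simp add: mult_ac)
  ultimately show ?thesis
    using norm_triangle_ineq[of "Y (Suc k) - ys (X k)" "ys (X k) - ys (X (Suc k))"] by simp
qed

lemma eU_Suc:
  "eU (Suc k) \<le> 1 / 6 * eU k + 7 / 6 * (L1 / \<mu> * eY k) + L1 / \<mu> * (1 + \<kappa>g) * \<alpha> * norm (dx k)"
proof -
  have "norm (U (Suc k) - us (X k)) \<le> 1 / 6 * eU k + 7 / 6 * (L1 / \<mu> * eY k)"
    using inexact_newton_u[OF \<gamma> inner_accuracy]
    unfolding state_Suc_result result_nbo_step by simp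
  moreover have "norm (us (X k) - us (X (Suc k))) \<le> L1 / \<mu> * (1 + \<kappa>g) * \<alpha> * norm (dx k)"
    using lip_u_star[of "X k" "X (Suc k)"] unfolding norm_X_Suc by (simp add: mult_ac)
  ultimately show ?thesis
    using norm_triangle_ineq[of "U (Suc k) - us (X k)" "us (X k) - us (X (Suc k))"] by simp
qed

lemma norm_dx_le:
  assumes "eU k \<le> 5 * L1 / (2 * Lg2)"
  shows "norm (dx k) \<le> Cf0 + Lg1 * (Lf0 / \<mu> + 5 * L1 / (2 * Lg2))"
proof -
  have "norm (U k) \<le> Lf0 / \<mu> + 5 * L1 / (2 * Lg2)"
    using norm_triangle_ineq[of "us (X k)" "U k - us (X k)"] norm_u_star[of "X k"] assms by simp
  then have "norm (J (X k, Y k) *v U k) \<le> Lg1 * (Lf0 / \<mu> + 5 * L1 / (2 * Lg2))"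
    using order_trans[OF norm_jac_vec_le mult_left_mono] const_pos by simp
  then show ?thesis
    using norm_triangle_ineq4[of "grad1 f (X k, Y k)" "J (X k, Y k) *v U k"] norm_grad1_f[of "(X k, Y k)"]
    by simp
qed

text \<open>The contractions leave enough room for the drift of the targets \<open>ys\<close> and \<open>us\<close>. For the first error,
  \<open>3 / 4\<close> of the radius \<open>\<mu> / (2 Lg2)\<close> remain after the update and the drift is at most a quarter of it.
  For the second error, in units of \<open>L1 / (2 Lg2)\<close>, the update gives \<open>5 / 6 + 7 / 6\<close> and the drift \<open>1 / 2\<close>,
  which is below \<open>5\<close>.\<close>

lemma errors_stay_small: "eY k \<le> \<mu> / (2 * Lg2) \<and> eU k \<le> 5 * L1 / (2 * Lg2)"
proof (induction k)
  case 0
  show ?case using init unfolding good_init_def Let_def state_0 by simp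
next
  case (Suc k)
  then have e: "eY k \<le> \<mu> / (2 * Lg2)" and w: "eU k \<le> 5 * L1 / (2 * Lg2)" by auto
  have "\<alpha> * norm (dx k) * \<kappa>g \<le> \<alpha> * (Cf0 + Lg1 * (Lf0 / \<mu> + 5 * L1 / (2 * Lg2))) * \<kappa>g"
    using norm_dx_le[OF w] \<alpha>_pos kg_ge_1 by (intro mult_right_mono mult_left_mono) auto
  then have drift: "\<kappa>g * \<alpha> * norm (dx k) \<le> \<mu> / (8 * Lg2)"
    using \<alpha>_drift by (simp add: mult_ac)
  have "eY (Suc k) \<le> 3 / 4 * (\<mu> / (2 * Lg2)) + \<mu> / (8 * Lg2)"
    using eY_Suc[OF e] e drift by linarith
  also have "\<dots> = \<mu> / (2 * Lg2)" by (simp add: field_simps)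
  finally have Y: "eY (Suc k) \<le> \<mu> / (2 * Lg2)" .
  have "(1 + \<kappa>g) * (\<alpha> * norm (dx k)) \<le> (2 * \<kappa>g) * (\<alpha> * norm (dx k))"
    using kg_ge_1 \<alpha>_pos by (intro mult_right_mono) auto
  also have "\<dots> \<le> 2 * (\<mu> / (8 * Lg2))" using drift by (simp add: mult_ac)
  finally have "L1 / \<mu> * ((1 + \<kappa>g) * (\<alpha> * norm (dx k))) \<le> L1 / \<mu> * (2 * (\<mu> / (8 * Lg2)))"
    using L1_pos const_pos by (intro mult_left_mono) auto
  then have 1: "L1 / \<mu> * (1 + \<kappa>g) * \<alpha> * norm (dx k) \<le> L1 / (4 * Lg2)"
    using const_pos by (simp add: mult_ac)
  have 2: "L1 / \<mu> * eY k \<le> L1 / (2 * Lg2)"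
    using mult_left_mono[OF e, of "L1 / \<mu>"] L1_pos const_pos by (simp add: mult_ac)
  have "L1 / (4 * Lg2) = 1 / 4 * (L1 / Lg2)" "L1 / (2 * Lg2) = 1 / 2 * (L1 / Lg2)"
    "5 * L1 / (2 * Lg2) = 5 / 2 * (L1 / Lg2)" by simp_all
  moreover have "L1 / Lg2 > 0" using L1_pos const_pos by simp
  ultimately have "eU (Suc k) \<le> 5 * L1 / (2 * Lg2)"
    using eU_Suc[of k] w 1 2 by linarith
  with Y show ?case by simp
qed

text \<open>Besides the negative multiple of \<open>|dPhi|\<^sup>2\<close>, polarisation of \<open>dx \<bullet> dPhi\<close> yields a negative multiple
  of \<open>|dx|\<^sup>2\<close>. It is what later pays for the drift of \<open>ys\<close> and \<open>us\<close>.\<close>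

lemma Phi_descent:
  "Phi f g (X (Suc k)) \<le> Phi f g (X k) - \<alpha> / 2 * (norm (dPhi (X k)))\<^sup>2
     - (\<alpha> / 2 - \<alpha>\<^sup>2 * (L1 * (1 + \<kappa>g)\<^sup>2)) * (norm (dx k))\<^sup>2
     + \<alpha> * (L1\<^sup>2 * (eY k)\<^sup>2 + Lg1\<^sup>2 * (eU k)\<^sup>2)"
proof -
  let ?G = "dPhi (X k)" and ?d = "dx k" and ?M = "L1 * (1 + \<kappa>g)\<^sup>2"
  have "Phi f g (X k + (- \<alpha> *\<^sub>R ?d)) \<le> Phi f g (X k) + (- \<alpha> *\<^sub>R ?d) \<bullet> ?G + ?M * (norm (- \<alpha> *\<^sub>R ?d))\<^sup>2"
    by (rule lipschitz_gradient_descent[OF gderiv_Phi lip_dPhi]) (use L1_pos in simp)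
  then have 1: "Phi f g (X (Suc k)) \<le> Phi f g (X k) - \<alpha> * (?d \<bullet> ?G) + \<alpha>\<^sup>2 * ?M * (norm ?d)\<^sup>2"
    by (simp add: X_Suc power_mult_distrib mult_ac)
  have polar: "- (d \<bullet> G) = (norm (d - G))\<^sup>2 / 2 - (norm d)\<^sup>2 / 2 - (norm G)\<^sup>2 / 2"
    for d G :: "real^'m"
    by (simp add: power2_norm_eq_inner inner_diff_left inner_diff_right inner_commute field_simps)
  have half: "a / 2 - b / 2 - c / 2 \<le> r - b / 2 - c / 2" if "a \<le> 2 * r" for a b c r :: real
    using that by linarith
  have "norm (?d - ?G) \<le> L1 * eY k + Lg1 * eU k"
    using hypergradient_error[of "X k" "Y k" "U k"] by simp
  then have "(norm (?d - ?G))\<^sup>2 \<le> (L1 * eY k + Lg1 * eU k)\<^sup>2"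
    by (rule power_mono) simp
  also have "\<dots> \<le> 2 * (L1\<^sup>2 * (eY k)\<^sup>2 + Lg1\<^sup>2 * (eU k)\<^sup>2)"
    using sum_squares_bound[of "L1 * eY k" "Lg1 * eU k"]
    by (simp add: power2_sum power_mult_distrib algebra_simps)
  finally have "- (?d \<bullet> ?G) \<le> (L1\<^sup>2 * (eY k)\<^sup>2 + Lg1\<^sup>2 * (eU k)\<^sup>2) - (norm ?d)\<^sup>2 / 2 - (norm ?G)\<^sup>2 / 2"
    unfolding polar[of ?d ?G] by (rule half)
  then have "\<alpha> * - (?d \<bullet> ?G) \<le> \<alpha> * ((L1\<^sup>2 * (eY k)\<^sup>2 + Lg1\<^sup>2 * (eU k)\<^sup>2) - (norm ?d)\<^sup>2 / 2 - (norm ?G)\<^sup>2 / 2)"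
    using \<alpha>_pos by (intro mult_left_mono) auto
  with 1 show ?thesis by (simp add: algebra_simps)
qed

text \<open>The weights are balanced as follows. One step of descent charges \<open>\<alpha> (L1\<^sup>2 eY\<^sup>2 + Lg1\<^sup>2 eU\<^sup>2)\<close>. The weight of
  \<open>eU\<^sup>2\<close> is chosen so that the contraction of \<open>eU\<^sup>2\<close> to a quarter pays for \<open>\<alpha> Lg1\<^sup>2 eU\<^sup>2\<close>. The coupling of \<open>eU\<close> to
  \<open>eY\<close> then creates a multiple of \<open>\<alpha> L1\<^sup>2 \<kappa>g\<^sup>2 eY\<^sup>2\<close>, which together with \<open>\<alpha> L1\<^sup>2 eY\<^sup>2\<close> is paid by the
  contraction of \<open>eY\<^sup>2\<close> to three quarters if its weight is a large enough multiple of the same quantity.\<close>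

definition "potential k = Phi f g (X k) + 100 * \<alpha> * L1\<^sup>2 * \<kappa>g\<^sup>2 * (eY k)\<^sup>2 + 2 * \<alpha> * Lg1\<^sup>2 * (eU k)\<^sup>2"

text \<open>The drift of both targets costs at most \<open>406 \<alpha> Q\<^sup>2 |dx|\<^sup>2\<close>, where \<open>Q\<close> is \<open>\<alpha>\<close> times the Lipschitz
  constant of the hypergradient. For \<open>Q \<le> 1 / 40\<close> this is covered by the term
  \<open>(\<alpha> / 2 - \<alpha> Q) |dx|\<^sup>2\<close> of the descent inequality.\<close>

lemma potential_decrease:
  "potential (Suc k) \<le> potential k - \<alpha> / 2 * (norm (dPhi (X k)))\<^sup>2"
proof -
  define e w s c e' w' where "e = eY k" and "w = eU k" and "s = norm (dx k)" and "c = 1 + \<kappa>g"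
    and "e' = eY (Suc k)" and "w' = eU (Suc k)"
  note defs = e_def w_def s_def c_def e'_def w'_def
  have k1: "\<kappa>g \<ge> 1" by (rule kg_ge_1)
  have e': "e'\<^sup>2 \<le> 3 / 4 * e\<^sup>2 + 4 * (\<kappa>g * \<alpha> * s)\<^sup>2"
  proof -
    have "e'\<^sup>2 \<le> (3 / 4 * e + \<kappa>g * \<alpha> * s)\<^sup>2"
      using eY_Suc errors_stay_small unfolding defs by (intro power_mono) auto
    also have "\<dots> \<le> 3 / 4 * e\<^sup>2 + 4 * (\<kappa>g * \<alpha> * s)\<^sup>2"
      \<comment> \<open>Young's inequality \<open>2 a b \<le> a\<^sup>2 / 3 + 3 b\<^sup>2\<close> with \<open>a = 3 e / 4\<close> and \<open>b = \<kappa>g \<alpha> s\<close>.\<close>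
      using zero_le_power2[of "e / 4 - \<kappa>g * \<alpha> * s"] by (simp add: power2_eq_square algebra_simps)
    finally show ?thesis .
  qed
  have w': "w'\<^sup>2 \<le> w\<^sup>2 / 4 + 12 * (L1 / \<mu> * e)\<^sup>2 + 3 * (L1 / \<mu> * c * \<alpha> * s)\<^sup>2"
  proof -
    define q where "q = L1 / \<mu> * e"
    define a b d where "a = 1 / 6 * w" and "b = 7 / 6 * q" and "d = L1 / \<mu> * c * \<alpha> * s"
    have "w' \<le> a + b + d" using eU_Suc[of k] unfolding defs a_def b_def d_def q_def by simp
    then have "w'\<^sup>2 \<le> (a + b + d)\<^sup>2" unfolding w'_def by (rule power_mono) simp
    also have "\<dots> \<le> 3 * a\<^sup>2 + 3 * b\<^sup>2 + 3 * d\<^sup>2"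
      using sum_squares_bound[of a b] sum_squares_bound[of b d] sum_squares_bound[of a d]
      by (simp add: power2_eq_square algebra_simps)
    also have "\<dots> = 1 / 12 * w\<^sup>2 + 49 / 12 * q\<^sup>2 + 3 * d\<^sup>2"
      by (simp add: a_def b_def power_mult_distrib power_divide)
    also have "\<dots> \<le> w\<^sup>2 / 4 + 12 * q\<^sup>2 + 3 * d\<^sup>2"
      using zero_le_power2[of w] zero_le_power2[of q] by linarith
    finally show ?thesis by (simp add: d_def q_def)
  qed
  define Q where "Q = \<alpha> * (L1 * c\<^sup>2)"
  have Q: "0 \<le> Q" "Q \<le> 1 / 40"
    using \<alpha>_pos L1_pos \<alpha>_smooth by (auto simp: Q_def c_def)
  have A: "100 * \<alpha> * L1\<^sup>2 * \<kappa>g\<^sup>2 * e'\<^sup>2 \<le> 75 * (\<alpha> * L1\<^sup>2 * \<kappa>g\<^sup>2 * e\<^sup>2) + 400 * (\<alpha> * (Q\<^sup>2 * s\<^sup>2))"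
  proof -
    have "100 * \<alpha> * L1\<^sup>2 * \<kappa>g\<^sup>2 * e'\<^sup>2 \<le> 100 * \<alpha> * L1\<^sup>2 * \<kappa>g\<^sup>2 * (3 / 4 * e\<^sup>2 + 4 * (\<kappa>g * \<alpha> * s)\<^sup>2)"
      using e' \<alpha>_pos by (intro mult_left_mono) auto
    also have "\<dots> = 75 * (\<alpha> * L1\<^sup>2 * \<kappa>g\<^sup>2 * e\<^sup>2) + 400 * (\<alpha> * ((\<alpha> * (L1 * \<kappa>g\<^sup>2))\<^sup>2 * s\<^sup>2))"
      by (simp add: algebra_simps power_mult_distrib power2_eq_square)
    also have "(\<alpha> * (L1 * \<kappa>g\<^sup>2))\<^sup>2 \<le> Q\<^sup>2"
      unfolding Q_def c_def using \<alpha>_pos L1_pos k1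
      by (intro power_mono mult_left_mono) auto
    then have "75 * (\<alpha> * L1\<^sup>2 * \<kappa>g\<^sup>2 * e\<^sup>2) + 400 * (\<alpha> * ((\<alpha> * (L1 * \<kappa>g\<^sup>2))\<^sup>2 * s\<^sup>2))
        \<le> 75 * (\<alpha> * L1\<^sup>2 * \<kappa>g\<^sup>2 * e\<^sup>2) + 400 * (\<alpha> * (Q\<^sup>2 * s\<^sup>2))"
      using \<alpha>_pos by (intro add_left_mono mult_left_mono mult_right_mono) auto
    finally show ?thesis .
  qed
  have B: "2 * \<alpha> * Lg1\<^sup>2 * w'\<^sup>2
      \<le> \<alpha> * Lg1\<^sup>2 * w\<^sup>2 / 2 + 24 * (\<alpha> * L1\<^sup>2 * \<kappa>g\<^sup>2 * e\<^sup>2) + 6 * (\<alpha> * (Q\<^sup>2 * s\<^sup>2))"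
  proof -
    have "2 * \<alpha> * Lg1\<^sup>2 * w'\<^sup>2
        \<le> 2 * \<alpha> * Lg1\<^sup>2 * (w\<^sup>2 / 4 + 12 * (L1 / \<mu> * e)\<^sup>2 + 3 * (L1 / \<mu> * c * \<alpha> * s)\<^sup>2)"
      using w' \<alpha>_pos by (intro mult_left_mono) auto
    also have "\<dots> = \<alpha> * Lg1\<^sup>2 * w\<^sup>2 / 2 + 24 * (\<alpha> * L1\<^sup>2 * \<kappa>g\<^sup>2 * e\<^sup>2)
        + 6 * (\<alpha> * ((\<alpha> * (L1 * (\<kappa>g * c)))\<^sup>2 * s\<^sup>2))"
      by (simp add: algebra_simps power_mult_distrib power2_eq_square)
    also have "(\<alpha> * (L1 * (\<kappa>g * c)))\<^sup>2 \<le> Q\<^sup>2"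
      unfolding Q_def c_def power2_eq_square[of "1 + \<kappa>g"] using \<alpha>_pos L1_pos k1 const_pos
      by (intro power_mono mult_left_mono mult_right_mono) auto
    then have "\<alpha> * Lg1\<^sup>2 * w\<^sup>2 / 2 + 24 * (\<alpha> * L1\<^sup>2 * \<kappa>g\<^sup>2 * e\<^sup>2)
        + 6 * (\<alpha> * ((\<alpha> * (L1 * (\<kappa>g * c)))\<^sup>2 * s\<^sup>2))
      \<le> \<alpha> * Lg1\<^sup>2 * w\<^sup>2 / 2 + 24 * (\<alpha> * L1\<^sup>2 * \<kappa>g\<^sup>2 * e\<^sup>2) + 6 * (\<alpha> * (Q\<^sup>2 * s\<^sup>2))"
      using \<alpha>_pos by (intro add_left_mono mult_left_mono mult_right_mono) auto
    finally show ?thesis .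
  qed
  have C: "\<alpha> * (L1\<^sup>2 * e\<^sup>2) \<le> \<alpha> * L1\<^sup>2 * \<kappa>g\<^sup>2 * e\<^sup>2"
    using mult_right_mono[OF one_le_power[OF k1, of 2], of "\<alpha> * (L1\<^sup>2 * e\<^sup>2)"] \<alpha>_pos
    by (simp add: mult_ac)
  have S: "406 * (\<alpha> * (Q\<^sup>2 * s\<^sup>2)) \<le> (\<alpha> / 2 - \<alpha> * Q) * s\<^sup>2"
  proof -
    have "Q\<^sup>2 \<le> Q * (1 / 40)" using mult_left_mono[OF Q(2) Q(1)] by (simp add: power2_eq_square)
    then have "406 * Q\<^sup>2 \<le> 1 / 2 - Q" using Q by linarith
    then have "(\<alpha> * s\<^sup>2) * (406 * Q\<^sup>2) \<le> (\<alpha> * s\<^sup>2) * (1 / 2 - Q)"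
      using \<alpha>_pos by (intro mult_left_mono) auto
    then show ?thesis by (simp add: algebra_simps)
  qed
  have W: "0 \<le> \<alpha> * Lg1\<^sup>2 * w\<^sup>2" using \<alpha>_pos by simp
  have "Phi f g (X (Suc k)) \<le> Phi f g (X k) - \<alpha> / 2 * (norm (dPhi (X k)))\<^sup>2
     - (\<alpha> / 2 - \<alpha> * Q) * s\<^sup>2 + \<alpha> * (L1\<^sup>2 * e\<^sup>2) + \<alpha> * Lg1\<^sup>2 * w\<^sup>2"
    using Phi_descent[of k] unfolding Q_def defs by (simp add: power2_eq_square algebra_simps)
  with A B C S W show ?thesis
    unfolding potential_def defs[symmetric] by linarith
qed

text \<open>The second bounds in the condition on the initial iterate, of order \<open>L1\<^sup>-\<^sup>1\<^sup>/\<^sup>2\<close> and \<open>L1\<^sup>1\<^sup>/\<^sup>2 / \<mu>\<close>, are made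
  for this estimate: both error terms become multiples of \<open>\<alpha> L1 \<kappa>g\<^sup>2\<close>.\<close>

lemma potential_0: "potential 0 \<le> Phi f g x0 + 2"
proof -
  have "eY 0 \<le> 1 / (2 * sqrt L1)" "eU 0 \<le> sqrt L1 / \<mu>"
    using init unfolding good_init_def Let_def state_0 by simp_all
  then have "(eY 0)\<^sup>2 \<le> (1 / (2 * sqrt L1))\<^sup>2" "(eU 0)\<^sup>2 \<le> (sqrt L1 / \<mu>)\<^sup>2"
    by (auto intro: power_mono[OF _ norm_ge_zero])
  then have "(eY 0)\<^sup>2 \<le> 1 / (4 * L1)" "(eU 0)\<^sup>2 \<le> L1 / \<mu>\<^sup>2"
    using L1_pos by (simp_all add: power_divide power_mult_distrib)
  then have "100 * \<alpha> * L1\<^sup>2 * \<kappa>g\<^sup>2 * (eY 0)\<^sup>2 \<le> 100 * \<alpha> * L1\<^sup>2 * \<kappa>g\<^sup>2 * (1 / (4 * L1))"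
    "2 * \<alpha> * Lg1\<^sup>2 * (eU 0)\<^sup>2 \<le> 2 * \<alpha> * Lg1\<^sup>2 * (L1 / \<mu>\<^sup>2)"
    using \<alpha>_pos by (intro mult_left_mono; simp)+
  moreover have "100 * \<alpha> * L1\<^sup>2 * \<kappa>g\<^sup>2 * (1 / (4 * L1)) = 25 * (\<alpha> * (L1 * \<kappa>g\<^sup>2))"
    "2 * \<alpha> * Lg1\<^sup>2 * (L1 / \<mu>\<^sup>2) = 2 * (\<alpha> * (L1 * \<kappa>g\<^sup>2))"
    using L1_pos by (simp_all add: power2_eq_square)
  moreover have "\<alpha> * (L1 * \<kappa>g\<^sup>2) \<le> \<alpha> * (L1 * (1 + \<kappa>g)\<^sup>2)"
    using \<alpha>_pos L1_pos kg_ge_1 by (intro mult_left_mono power_mono) auto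
  ultimately show ?thesis
    using \<alpha>_smooth unfolding potential_def state_0 by linarith
qed

lemma sum_norm_grad_Phi_le:
  assumes bdd: "bdd_below (range (Phi f g))"
  shows "\<alpha> * (\<Sum>k<K. (norm (grad (Phi f g) (X k)))\<^sup>2) \<le> 2 * Phi f g x0 - 2 * Phi_opt f g + 4"
proof -
  have "potential K + \<alpha> / 2 * (\<Sum>k<K. (norm (dPhi (X k)))\<^sup>2) \<le> potential 0"
  proof (induction K)
    case (Suc K)
    then show ?case using potential_decrease[of K] by (simp add: algebra_simps)
  qed simp
  moreover have "Phi_opt f g \<le> Phi f g (X K)"
    unfolding Phi_opt_def using bdd by (intro cINF_lower) auto
  moreover have "Phi f g (X K) \<le> potential K"
    using \<alpha>_pos by (simp add: potential_def)
  ultimately show ?thesis using potential_0 by (simp add: grad_Phi)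
qed

end

section \<open>Choice of the step size and of the number of inner iterations\<close>

text \<open>Bernoulli's inequality for \<open>(1 + q)\<^sup>n\<close> and \<open>(1 - q) (1 + q) \<le> 1\<close>.\<close>

lemma power_one_minus_le:
  fixes q :: real
  assumes "0 \<le> q" "q \<le> 1"
  shows "(1 - q) ^ n \<le> 1 / (1 + real n * q)"
proof -
  have "(1 - q) ^ n * (1 + real n * q) \<le> (1 - q) ^ n * (1 + q) ^ n"
    using assms by (intro mult_left_mono Bernoulli_inequality) auto
  also have "\<dots> = (1 - q\<^sup>2) ^ n"
    by (simp add: power_mult_distrib[symmetric] power2_eq_square algebra_simps)
  also have "\<dots> \<le> 1"
    using assms by (intro power_le_one) (auto simp: power_le_one)
  finally show ?thesis using assms by (simp add: pos_le_divide_eq add_pos_nonneg)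
qed

text \<open>In the next definitions \<open>\<mu>\<close> is eliminated through \<open>1 / \<mu> = \<kappa> / max Lg1 Lf1\<close>: the factors \<open>L1_coeff\<close> and
  \<open>direction_coeff\<close> bound \<open>L1 / \<kappa>\<close> and \<open>|dx| / \<kappa>\<close> independently of \<open>\<mu>\<close>, using \<open>\<kappa> \<ge> 1\<close>. The two terms in the
  minimum of \<open>step_coeff\<close> serve \<open>\<alpha>_smooth\<close> and \<open>\<alpha>_drift\<close>.\<close>

definition L1_coeff :: "real \<Rightarrow> real \<Rightarrow> real \<Rightarrow> real \<Rightarrow> real" where
  "L1_coeff Lf0 Lf1 Lg1 Lg2 = Lf1 + Lg2 * Lf0 / max Lg1 Lf1"

definition direction_coeff :: "real \<Rightarrow> real \<Rightarrow> real \<Rightarrow> real \<Rightarrow> real \<Rightarrow> real" where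
  "direction_coeff Lf0 Lf1 Lg1 Lg2 Cf0 =
     Cf0 + Lg1 * Lf0 / max Lg1 Lf1 + 5 * Lg1 * L1_coeff Lf0 Lf1 Lg1 Lg2 / (2 * Lg2)"

definition step_coeff :: "real \<Rightarrow> real \<Rightarrow> real \<Rightarrow> real \<Rightarrow> real \<Rightarrow> real" where
  "step_coeff Lf0 Lf1 Lg1 Lg2 Cf0 = min (1 / (160 * L1_coeff Lf0 Lf1 Lg1 Lg2))
     (max Lg1 Lf1 / (8 * Lg2 * direction_coeff Lf0 Lf1 Lg1 Lg2 Cf0))"

lemma coeff_pos:
  assumes "Lf0 > 0" "Lf1 > 0" "Lg1 > 0" "Lg2 > 0" "Cf0 > 0"
  shows "L1_coeff Lf0 Lf1 Lg1 Lg2 > 0" "direction_coeff Lf0 Lf1 Lg1 Lg2 Cf0 > 0"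
    "step_coeff Lf0 Lf1 Lg1 Lg2 Cf0 > 0"
proof -
  have m: "max Lg1 Lf1 > 0" using assms by simp
  show 1: "L1_coeff Lf0 Lf1 Lg1 Lg2 > 0"
    unfolding L1_coeff_def using assms m by (intro add_pos_pos divide_pos_pos mult_pos_pos) auto
  show 2: "direction_coeff Lf0 Lf1 Lg1 Lg2 Cf0 > 0"
    unfolding direction_coeff_def using assms m 1 by (intro add_pos_pos divide_pos_pos mult_pos_pos) auto
  show "step_coeff Lf0 Lf1 Lg1 Lg2 Cf0 > 0"
    unfolding step_coeff_def using assms m 1 2 by simp
qed

context bilevel
begin

abbreviation "\<kappa> \<equiv> cond_number \<mu> Lf1 Lg1"

lemma kg_le_cond_number: "\<kappa>g \<le> \<kappa>" and cond_number_ge_1: "\<kappa> \<ge> 1"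
proof -
  show "\<kappa>g \<le> \<kappa>" unfolding cond_number_def using const_pos by (intro divide_right_mono) auto
  then show "\<kappa> \<ge> 1" using kg_ge_1 by linarith
qed

lemma inverse_mu: "1 / \<mu> = \<kappa> / max Lg1 Lf1"
  using const_pos by (simp add: cond_number_def)

lemma L1_le: "L1 \<le> L1_coeff Lf0 Lf1 Lg1 Lg2 * \<kappa>"
proof -
  have "L1 = Lf1 * 1 + Lg2 * Lf0 * (\<kappa> / max Lg1 Lf1)"
    unfolding L1_const_def inverse_mu[symmetric] by simp
  also have "\<dots> \<le> Lf1 * \<kappa> + Lg2 * Lf0 * (\<kappa> / max Lg1 Lf1)"
    using cond_number_ge_1 const_pos by (intro add_right_mono mult_left_mono) auto
  finally show ?thesis by (simp add: L1_coeff_def algebra_simps)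
qed

lemma direction_bound_le:
  "Cf0 + Lg1 * (Lf0 / \<mu> + 5 * L1 / (2 * Lg2)) \<le> direction_coeff Lf0 Lf1 Lg1 Lg2 Cf0 * \<kappa>"
proof -
  have "Cf0 + Lg1 * (Lf0 / \<mu> + 5 * L1 / (2 * Lg2))
      = Cf0 * 1 + Lg1 * Lf0 * (\<kappa> / max Lg1 Lf1) + 5 * Lg1 / (2 * Lg2) * L1"
    unfolding inverse_mu[symmetric] by (simp add: algebra_simps)
  also have "\<dots> \<le> Cf0 * \<kappa> + Lg1 * Lf0 * (\<kappa> / max Lg1 Lf1)
      + 5 * Lg1 / (2 * Lg2) * (L1_coeff Lf0 Lf1 Lg1 Lg2 * \<kappa>)"
    using cond_number_ge_1 const_pos L1_le by (intro add_mono mult_left_mono) auto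
  also have "\<dots> = direction_coeff Lf0 Lf1 Lg1 Lg2 Cf0 * \<kappa>"
    by (simp add: direction_coeff_def algebra_simps)
  finally show ?thesis .
qed

lemma nbo_runI:
  assumes \<gamma>: "0 < \<gamma>" "\<gamma> \<le> 1 / Lg1"
    and T: "5 / (\<gamma> * max Lg1 Lf1) * \<kappa> \<le> real T"
    and init: "good_init f g \<mu> Lf0 Lf1 Lg2 y0 u0 x0"
  shows "nbo_run f g \<mu> Lf0 Lf1 Lg1 Lg2 Cf0 \<gamma> (step_coeff Lf0 Lf1 Lg1 Lg2 Cf0 / \<kappa> ^ 3) T y0 u0 x0"
proof -
  define B D c m where "B = L1_coeff Lf0 Lf1 Lg1 Lg2" and "D = direction_coeff Lf0 Lf1 Lg1 Lg2 Cf0"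
    and "c = step_coeff Lf0 Lf1 Lg1 Lg2 Cf0" and "m = max Lg1 Lf1"
  have pos: "B > 0" "D > 0" "c > 0"
    unfolding B_def D_def c_def by (rule coeff_pos[OF const_pos(2-6)])+
  have m: "m > 0" using const_pos by (simp add: m_def)
  have k1: "\<kappa> \<ge> 1" by (rule cond_number_ge_1)
  have \<alpha>_nonneg: "0 \<le> c / \<kappa> ^ 3" using pos k1 by simp
  have "(1 - \<gamma> * \<mu>) ^ Suc T \<le> 1 / 6"
  proof -
    have \<gamma>L: "\<gamma> * Lg1 \<le> 1" using \<gamma> const_pos by (simp add: field_simps)
    have q: "0 \<le> \<gamma> * \<mu>" "\<gamma> * \<mu> \<le> 1"
      using \<gamma> const_pos order_trans[OF mult_left_mono[OF mu_le_Lg1] \<gamma>L] by simp_all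
    have "5 / (\<gamma> * m) * \<kappa> = 5 / \<gamma> * (\<kappa> / m)" by simp
    also have "\<dots> = 5 / (\<gamma> * \<mu>)" unfolding m_def inverse_mu[symmetric] by simp
    finally have "5 / (\<gamma> * \<mu>) \<le> real T" using T by (simp add: m_def)
    then have "5 \<le> real T * (\<gamma> * \<mu>)" using \<gamma> const_pos by (simp add: pos_divide_le_eq)
    also have "\<dots> \<le> real (Suc T) * (\<gamma> * \<mu>)" using q by (intro mult_right_mono) auto
    finally have "1 / (1 + real (Suc T) * (\<gamma> * \<mu>)) \<le> 1 / 6" by (intro divide_left_mono) auto
    then show ?thesis using power_one_minus_le[OF q, of "Suc T"] by linarith
  qed
  moreover have "c / \<kappa> ^ 3 * (L1 * (1 + \<kappa>g)\<^sup>2) \<le> 1 / 40"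
  proof -
    have "L1 * (1 + \<kappa>g)\<^sup>2 \<le> (B * \<kappa>) * (2 * \<kappa>)\<^sup>2"
      using L1_le kg_le_cond_number k1 kg_ge_1 L1_pos pos
      by (intro mult_mono power_mono) (auto simp: B_def)
    then have "c / \<kappa> ^ 3 * (L1 * (1 + \<kappa>g)\<^sup>2) \<le> c / \<kappa> ^ 3 * ((B * \<kappa>) * (2 * \<kappa>)\<^sup>2)"
      using \<alpha>_nonneg by (rule mult_left_mono)
    also have "\<dots> = 4 * B * c" using k1 by (simp add: power2_eq_square power3_eq_cube)
    also have "\<dots> \<le> 4 * B * (1 / (160 * B))"
      using pos by (intro mult_left_mono) (auto simp: c_def step_coeff_def B_def)
    also have "\<dots> = 1 / 40" using pos by simp
    finally show ?thesis .
  qed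
  moreover have "c / \<kappa> ^ 3 * (Cf0 + Lg1 * (Lf0 / \<mu> + 5 * L1 / (2 * Lg2))) * \<kappa>g \<le> \<mu> / (8 * Lg2)"
  proof -
    have "c / \<kappa> ^ 3 * (Cf0 + Lg1 * (Lf0 / \<mu> + 5 * L1 / (2 * Lg2))) * \<kappa>g \<le> c / \<kappa> ^ 3 * (D * \<kappa>) * \<kappa>"
      using direction_bound_le \<alpha>_nonneg kg_le_cond_number kg_ge_1 pos k1
      by (intro mult_mono mult_left_mono) (auto simp: D_def)
    also have "\<dots> = D / \<kappa> * c" using k1 by (simp add: power3_eq_cube)
    also have "\<dots> \<le> D / \<kappa> * (m / (8 * Lg2 * D))"
      using pos k1 by (intro mult_left_mono) (auto simp: c_def step_coeff_def D_def m_def)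
    also have "\<dots> = (m / \<kappa>) / (8 * Lg2)" using pos by simp
    also have "m / \<kappa> = \<mu>" using m const_pos by (simp add: m_def cond_number_def)
    finally show ?thesis .
  qed
  moreover have "0 < c / \<kappa> ^ 3" using pos k1 by simp
  ultimately show ?thesis
    using \<gamma> init unfolding c_def
    by (intro nbo_run.intro bilevel_axioms nbo_run_axioms.intro)
qed

end

section \<open>Convergence rate and complexity\<close>

lemma init_cost_bound_le_cube:
  assumes "init_cost_bound C \<kappa> N" "\<kappa> \<ge> 1" "C > 0"
  shows "real N \<le> C * \<kappa> ^ 3"
proof -
  have "\<kappa> * (1 + ln \<kappa>) \<le> \<kappa> * \<kappa>"
    using ln_le_minus_one[of \<kappa>] assms(2) by (intro mult_left_mono) auto
  also have "\<dots> \<le> \<kappa> ^ 3"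
    using power_increasing[of 2 3 \<kappa>] assms(2) by (simp add: power2_eq_square)
  finally have "C * (\<kappa> * (1 + ln \<kappa>)) \<le> C * \<kappa> ^ 3" using assms(3) by (intro mult_left_mono) auto
  then show ?thesis using assms(1) unfolding init_cost_bound_def by linarith
qed

lemma Min_le_average:
  fixes h :: "nat \<Rightarrow> real"
  assumes "K \<ge> 1"
  shows "real K * (MIN k\<in>{0..K - 1}. h k) \<le> (\<Sum>k<K. h k)"
proof -
  have "(\<Sum>k<K. h k) \<ge> (\<Sum>k<K. (MIN k\<in>{0..K - 1}. h k))"
    using assms by (intro sum_mono Min_le) auto
  then show ?thesis by simp
qed

theorem theorem3p2:
  fixes Lf0 Lf1 Lg1 Lg2 Cf0 \<gamma> \<Delta> Cinit :: real
  assumes "Lf0 > 0" "Lf1 > 0" "Lg1 > 0" "Lg2 > 0" "Cf0 > 0"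
    and "0 < \<gamma>" "\<gamma> \<le> 1 / Lg1"
    and "Cinit > 0"
  shows "\<exists>c\<^sub>\<alpha> C\<^sub>\<alpha> c\<^sub>T C\<^sub>T C. c\<^sub>\<alpha> > 0 \<and> C\<^sub>\<alpha> > 0 \<and> c\<^sub>T > 0 \<and> C\<^sub>T > 0 \<and> C > 0 \<and>
    (\<forall>\<mu> (f :: (real^'m) \<times> (real^'n) \<Rightarrow> real) (g :: (real^'m) \<times> (real^'n) \<Rightarrow> real) y0 u0 x0.
      basic_assumption f g \<mu> Lf0 Lf1 Lg1 Lg2 Cf0 \<longrightarrow>
      bdd_below (range (Phi f g)) \<longrightarrow>
      Phi f g x0 - Phi_opt f g = \<Delta> \<longrightarrow>
      good_init f g \<mu> Lf0 Lf1 Lg2 y0 u0 x0 \<longrightarrow>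
      (let \<kappa> = cond_number \<mu> Lf1 Lg1 in
       \<exists>(\<alpha>::real) (T\<^sub>0::real) (T::nat).
         c\<^sub>\<alpha> / \<kappa>^3 \<le> \<alpha> \<and> \<alpha> \<le> C\<^sub>\<alpha> / \<kappa>^3 \<and>
         c\<^sub>T * \<kappa> \<le> T\<^sub>0 \<and> T\<^sub>0 \<le> C\<^sub>T * \<kappa> \<and> T\<^sub>0 \<le> real T \<and>
         (let run = nbo_gd f g T (\<lambda>_. \<alpha>) (\<lambda>_. \<gamma>) (y0, u0, x0);
              x = x_iter f g T (\<lambda>_. \<alpha>) (\<lambda>_. \<gamma>) (y0, u0, x0)
          in
           (\<forall>K::nat. K \<ge> 1 \<longrightarrow>
              (MIN k\<in>{0..K - 1}. (norm (grad (Phi f g) (x k)))\<^sup>2)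
                \<le> (2 * Phi f g x0 - 2 * Phi_opt f g + 4) / (\<alpha> * real K) \<and>
              (2 * Phi f g x0 - 2 * Phi_opt f g + 4) / (\<alpha> * real K) \<le> C * (\<kappa>^3 / real K)) \<and>
           (\<forall>\<epsilon>. 0 < \<epsilon> \<and> \<epsilon> \<le> 1 \<longrightarrow>
              (\<exists>K::nat. K \<ge> 1 \<and> real K \<le> C * (\<kappa>^3 / \<epsilon>) \<and>
                (\<exists>k\<in>{0..K - 1}. eps_optimal f g \<epsilon> (x k)) \<and>
                (\<forall>Ng Nh. init_cost_bound Cinit \<kappa> Ng \<and> init_cost_bound Cinit \<kappa> Nh \<longrightarrow>
                   real (Ng + grads (run K)) \<le> C * (\<kappa>^3 / \<epsilon>) \<and>
                   real (jvps (run K)) \<le> C * (\<kappa>^3 / \<epsilon>) \<and>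
                   real (Nh + hvps (run K)) \<le> C * (\<kappa>^4 / \<epsilon>)))))))"
proof -
  define c where "c = step_coeff Lf0 Lf1 Lg1 Lg2 Cf0"
  define t where "t = 5 / (\<gamma> * max Lg1 Lf1)"
  \<comment> \<open>\<open>\<bar>\<Delta>\<bar>\<close> keeps the constants positive when no problem instance with this \<open>\<Delta>\<close> exists.\<close>
  define D where "D = (2 * \<bar>\<Delta>\<bar> + 4) / c"
  define C where "C = Cinit + (2 * t + 5) * (D + 1)"
  have c: "c > 0" unfolding c_def by (rule coeff_pos(3)[OF assms(1-5)])
  have t: "t > 0" using assms by (simp add: t_def)
  have D: "D > 0" using c by (simp add: D_def add_nonneg_pos)
  have C1: "Cinit + 3 * (D + 1) \<le> C"
    unfolding C_def using t D by (intro add_left_mono mult_right_mono) auto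
  have C2: "D + 1 \<le> C" "D \<le> C" "C > 0" using C1 D assms(8) by auto
  show ?thesis
  proof (rule exI[of _ c], rule exI[of _ c], rule exI[of _ t], rule exI[of _ t], rule exI[of _ C],
      intro conjI allI impI c t \<open>C > 0\<close>)
    fix \<mu> and f g :: "(real^'m) \<times> (real^'n) \<Rightarrow> real" and y0 u0 x0
    assume basic: "basic_assumption f g \<mu> Lf0 Lf1 Lg1 Lg2 Cf0"
      and bdd: "bdd_below (range (Phi f g))" and \<Delta>: "Phi f g x0 - Phi_opt f g = \<Delta>"
      and init: "good_init f g \<mu> Lf0 Lf1 Lg2 y0 u0 x0"
    interpret bilevel f g \<mu> Lf0 Lf1 Lg1 Lg2 Cf0 by unfold_locales (rule basic)
    define \<alpha> where "\<alpha> = c / \<kappa> ^ 3"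
    define T where "T = nat \<lceil>t * \<kappa>\<rceil>"
    have k1: "\<kappa> \<ge> 1" by (rule cond_number_ge_1)
    have \<alpha>: "\<alpha> > 0" using c k1 by (simp add: \<alpha>_def)
    have "0 \<le> t * \<kappa>" using t k1 by simp
    then have T: "t * \<kappa> \<le> real T" "real T \<le> t * \<kappa> + 1" unfolding T_def by linarith+
    interpret nbo_run f g \<mu> Lf0 Lf1 Lg1 Lg2 Cf0 \<gamma> \<alpha> T y0 u0 x0
      unfolding \<alpha>_def c_def using T(1) assms(6,7) init by (intro nbo_runI) (simp_all add: t_def)
    define x where "x = x_iter f g T (\<lambda>_. \<alpha>) (\<lambda>_. \<gamma>) (y0, u0, x0)"
    define run where "run = nbo_gd f g T (\<lambda>_. \<alpha>) (\<lambda>_. \<gamma>) (y0, u0, x0)"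
    define h where "h k = (norm (grad (Phi f g) (x k)))\<^sup>2" for k
    have X: "X k = x k" for k by (simp add: x_def x_iter_def state_def)
    let ?R = "2 * Phi f g x0 - 2 * Phi_opt f g + 4"
    have R_\<alpha>: "?R / (\<alpha> * r) \<le> D * (\<kappa> ^ 3 / r)" if "r > 0" for r
    proof -
      have "?R \<le> 2 * \<bar>\<Delta>\<bar> + 4" using \<Delta> by linarith
      then have "?R / (\<alpha> * r) \<le> (2 * \<bar>\<Delta>\<bar> + 4) / (\<alpha> * r)"
        using \<alpha> that by (intro divide_right_mono) auto
      then show ?thesis by (simp add: \<alpha>_def D_def)
    qed
    have min_le: "(MIN k\<in>{0..K - 1}. h k) \<le> ?R / (\<alpha> * real K)" if K: "K \<ge> 1" for K
    proof -
      have "\<alpha> * (real K * (MIN k\<in>{0..K - 1}. h k)) \<le> \<alpha> * (\<Sum>k<K. h k)"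
        using Min_le_average[OF K, of h] \<alpha> by (intro mult_left_mono) auto
      also have "\<dots> \<le> ?R"
        using sum_norm_grad_Phi_le[OF bdd, of K] by (simp add: X h_def)
      finally show ?thesis using \<alpha> K by (simp add: pos_le_divide_eq mult_ac)
    qed
    have complexity: "\<exists>K::nat. K \<ge> 1 \<and> real K \<le> C * (\<kappa>^3 / \<epsilon>) \<and>
        (\<exists>k\<in>{0..K - 1}. eps_optimal f g \<epsilon> (x k)) \<and>
        (\<forall>Ng Nh. init_cost_bound Cinit \<kappa> Ng \<and> init_cost_bound Cinit \<kappa> Nh \<longrightarrow>
           real (Ng + grads (run K)) \<le> C * (\<kappa>^3 / \<epsilon>) \<and>
           real (jvps (run K)) \<le> C * (\<kappa>^3 / \<epsilon>) \<and>
           real (Nh + hvps (run K)) \<le> C * (\<kappa>^4 / \<epsilon>))" if \<epsilon>: "0 < \<epsilon>" "\<epsilon> \<le> 1" for \<epsilon>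
    proof -
      define N where "N = \<kappa> ^ 3 / \<epsilon>"
      have "1 \<le> \<kappa> ^ 3" using k1 by simp
      also have k3: "\<kappa> ^ 3 \<le> N"
        unfolding N_def using \<epsilon> k1 by (simp add: pos_le_divide_eq mult_left_le)
      finally have N1: "1 \<le> N" .
      \<comment> \<open>With this many steps the bound \<open>D \<kappa>\<^sup>3 / K\<close> on the minimum drops below \<open>\<epsilon>\<close>.\<close>
      define K where "K = nat \<lceil>D * N\<rceil>"
      have DN: "D * N > 0" using D N1 by simp
      then have K: "K \<ge> 1" "D * N \<le> real K" "real K \<le> D * N + 1" unfolding K_def by linarith+
      then have KN: "real K \<le> (D + 1) * N" using N1 by (simp add: algebra_simps)
      have KC: "real K \<le> C * N"
        by (rule order_trans[OF KN mult_right_mono[OF C2(1)]]) (use N1 in simp)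
      have "\<exists>k\<in>{0..K - 1}. eps_optimal f g \<epsilon> (x k)"
      proof -
        have "(MIN k\<in>{0..K - 1}. h k) \<in> h ` {0..K - 1}" by (intro Min_in) auto
        then obtain k where k: "k \<in> {0..K - 1}" "(MIN k\<in>{0..K - 1}. h k) = h k" by (rule imageE)
        have "h k \<le> D * (\<kappa> ^ 3 / real K)"
          using min_le[OF K(1)] R_\<alpha>[of "real K"] K(1) k(2) by simp
        also have "\<dots> = D * N * \<epsilon> / real K" using \<epsilon> by (simp add: N_def)
        also have "\<dots> \<le> \<epsilon>" using K \<epsilon> by (simp add: pos_divide_le_eq)
        finally show ?thesis using k(1) by (auto simp: eps_optimal_def h_def)
      qed
      moreover have "real (Ng + grads (run K)) \<le> C * N \<and> real (jvps (run K)) \<le> C * N \<and>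
          real (Nh + hvps (run K)) \<le> C * (\<kappa>^4 / \<epsilon>)"
        if "init_cost_bound Cinit \<kappa> Ng" "init_cost_bound Cinit \<kappa> Nh" for Ng Nh
      proof (intro conjI)
        have init: "real n \<le> Cinit * N" if "init_cost_bound Cinit \<kappa> n" for n
          using init_cost_bound_le_cube[OF that k1 assms(8)] mult_left_mono[OF k3, of Cinit] assms(8)
          by linarith
        have "real (Ng + grads (run K)) \<le> Cinit * N + 3 * ((D + 1) * N)"
          using init[OF that(1)] KN by (simp add: run_def nbo_gd_cost)
        also have "\<dots> = (Cinit + 3 * (D + 1)) * N" by (simp add: algebra_simps)
        also have "\<dots> \<le> C * N" using C1 N1 by (intro mult_right_mono) auto
        finally show "real (Ng + grads (run K)) \<le> C * N" .
        show "real (jvps (run K)) \<le> C * N"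
          using KC by (simp add: run_def nbo_gd_cost)
        have "real (2 * T + 3) \<le> (2 * t + 5) * \<kappa>"
        proof -
          have "real (2 * T + 3) \<le> 2 * (t * \<kappa>) + 5 * \<kappa>" using T(2) k1 by simp
          then show ?thesis by (simp add: algebra_simps)
        qed
        then have "real ((2 * T + 3) * K) \<le> ((2 * t + 5) * \<kappa>) * ((D + 1) * N)"
          unfolding of_nat_mult using KN t k1 by (intro mult_mono) auto
        moreover have "Cinit * N * 1 \<le> Cinit * N * \<kappa>"
          using assms(8) N1 k1 by (intro mult_left_mono) auto
        ultimately have "real (Nh + hvps (run K)) \<le> Cinit * N * \<kappa> + ((2 * t + 5) * \<kappa>) * ((D + 1) * N)"
          using init[OF that(2)] unfolding run_def nbo_gd_cost of_nat_add by linarith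
        also have "\<dots> = C * (\<kappa> * N)" by (simp add: C_def algebra_simps)
        also have "\<kappa> * N = \<kappa> ^ 4 / \<epsilon>" by (simp add: N_def power4_eq_xxxx power3_eq_cube)
        finally show "real (Nh + hvps (run K)) \<le> C * (\<kappa> ^ 4 / \<epsilon>)" .
      qed
      ultimately show ?thesis using K(1) KC unfolding N_def by blast
    qed
    have rate: "(MIN k\<in>{0..K - 1}. (norm (grad (Phi f g) (x k)))\<^sup>2) \<le> ?R / (\<alpha> * real K) \<and>
        ?R / (\<alpha> * real K) \<le> C * (\<kappa> ^ 3 / real K)" if K: "K \<ge> 1" for K
    proof
      show "(MIN k\<in>{0..K - 1}. (norm (grad (Phi f g) (x k)))\<^sup>2) \<le> ?R / (\<alpha> * real K)"
        using min_le[OF K] by (simp add: h_def)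
      have "D * (\<kappa> ^ 3 / real K) \<le> C * (\<kappa> ^ 3 / real K)"
        using C2 k1 by (intro mult_right_mono) auto
      then show "?R / (\<alpha> * real K) \<le> C * (\<kappa> ^ 3 / real K)"
        using R_\<alpha>[of "real K"] K by simp
    qed
    show "let \<kappa> = cond_number \<mu> Lf1 Lg1 in
       \<exists>(\<alpha>::real) (T\<^sub>0::real) (T::nat).
         c / \<kappa>^3 \<le> \<alpha> \<and> \<alpha> \<le> c / \<kappa>^3 \<and>
         t * \<kappa> \<le> T\<^sub>0 \<and> T\<^sub>0 \<le> t * \<kappa> \<and> T\<^sub>0 \<le> real T \<and>
         (let run = nbo_gd f g T (\<lambda>_. \<alpha>) (\<lambda>_. \<gamma>) (y0, u0, x0);
              x = x_iter f g T (\<lambda>_. \<alpha>) (\<lambda>_. \<gamma>) (y0, u0, x0)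
          in
           (\<forall>K::nat. K \<ge> 1 \<longrightarrow>
              (MIN k\<in>{0..K - 1}. (norm (grad (Phi f g) (x k)))\<^sup>2)
                \<le> (2 * Phi f g x0 - 2 * Phi_opt f g + 4) / (\<alpha> * real K) \<and>
              (2 * Phi f g x0 - 2 * Phi_opt f g + 4) / (\<alpha> * real K) \<le> C * (\<kappa>^3 / real K)) \<and>
           (\<forall>\<epsilon>. 0 < \<epsilon> \<and> \<epsilon> \<le> 1 \<longrightarrow>
              (\<exists>K::nat. K \<ge> 1 \<and> real K \<le> C * (\<kappa>^3 / \<epsilon>) \<and>
                (\<exists>k\<in>{0..K - 1}. eps_optimal f g \<epsilon> (x k)) \<and>
                (\<forall>Ng Nh. init_cost_bound Cinit \<kappa> Ng \<and> init_cost_bound Cinit \<kappa> Nh \<longrightarrow>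
                   real (Ng + grads (run K)) \<le> C * (\<kappa>^3 / \<epsilon>) \<and>
                   real (jvps (run K)) \<le> C * (\<kappa>^3 / \<epsilon>) \<and>
                   real (Nh + hvps (run K)) \<le> C * (\<kappa>^4 / \<epsilon>)))))"
      unfolding Let_def
    proof (rule exI[of _ \<alpha>], rule exI[of _ "t * \<kappa>"], rule exI[of _ T], intro conjI allI impI)
      show "c / \<kappa> ^ 3 \<le> \<alpha>" "\<alpha> \<le> c / \<kappa> ^ 3" by (simp_all add: \<alpha>_def)
      show "t * \<kappa> \<le> real T" by (rule T(1))
    qed (use rate complexity in \<open>auto simp only: x_def run_def\<close>)
  qed
qed

end
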